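(* Let $T$ be an $n\times n$ complex matrix with $\|T\|<1$ (operator norm), and let $\widehat{T}$ be any Nelson dilation of $T$. Let $M_{\widehat{T}}|_{H^2_n}$ and $M_{\widehat{T}}|_{L^2_n}$ denote the operators of multiplication by $\widehat{T}$ on $H^2_n$ and $L^2_n$ respectively. Then $M_{\widehat{T}}|_{H_n^2}$ is a minimal isometric dilation of $T$ and $M_{\widehat{T}}|_{L_n^2}$ is a minimal unitary dilation of $T$.
   Context: $\mathbb{D}$ is the open unit disk and $\mathbb{T}$ the unit circle in $\mathbb{C}$. Nelson dilation: Let $T$ be an $n\times n$ complex matrix with $\|T\|<1$. Write $T=U\,\mathrm{diag}(s_1,\dots,s_n)\,V^*$ with $U,V$ unitary and (phased) singular values $s_1,\dots,s_n\in\mathbb{D}$ (the $s_i$ may be complex). Let $b_1,\dots,b_n$ be automorphisms of $\mathbb{D}$, $b_i(z)=\lambda_i\frac{z+a_i}{1+\bar a_i z}$ with $\lambda_i\in\mathbb{T}$, $a_i\in\mathbb{D}$, such that $b_i(0)=s_i$ for all $i$. Any matrix-valued function of the form $\widehat{T}(z)=U\,\mathrm{diag}(b_1(z),\dots,b_n(z))\,V^*$ arising this way is called an (automorphic) Nelson dilation of $T$; it satisfies $\widehat{T}(0)=T$. Spaces: $H^2_n=H^2(\mathbb{D})\otimes\mathbb{C}^n$ is the $\mathbb{C}^n$-valued Hardy space and $L^2_n=L^2(\mathbb{T})\otimes\mathbb{C}^n$; $\mathbb{C}^n\subseteq H^2_n\subseteq L^2_n$, with $\mathbb{C}^n$ identified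 with the constant functions. Dilations: Let $S$ be a bounded operator on a Hilbert space $\mathcal{H}$ with $\|S\|\le 1$. A unitary (resp. isometry) $W$ on a Hilbert space $\mathcal{K}\supseteq\mathcal{H}$ is a unitary (resp. isometric) dilation of $S$ if $S^k=P_{\mathcal{H}}W^k|_{\mathcal{H}}$ for all $k\in\mathbb{N}$, where $P_{\mathcal H}$ is the orthogonal projection onto $\mathcal H$. An isometric dilation $W$ is minimal if $\mathcal{K}=\overline{\mathrm{span}}\{W^m h: h\in\mathcal{H},\ m\in\mathbb{N}\}$. A unitary dilation $W$ is minimal if $\mathcal{K}=\overline{\mathrm{span}}\{W^m h: h\in\mathcal{H},\ m\in\mathbb{Z}\}$. Here $\mathbb{N}$ includes $0$. *)

theory Defs
  imports "HOL-Analysis.Analysis"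
begin

section \<open>Complex inner product spaces\<close>

text \<open>The inner product is linear in the first argument. Norm and topology are those of the
  underlying real inner product space, so \<open>norm x ^ 2 = cinner x x\<close>.\<close>

class complex_inner = real_inner +
  fixes scaleC :: "complex \<Rightarrow> 'a \<Rightarrow> 'a"
    and cinner :: "'a \<Rightarrow> 'a \<Rightarrow> complex"
  assumes scaleC_add_right: "scaleC c (x + y) = scaleC c x + scaleC c y"
    and scaleC_add_left: "scaleC (c + d) x = scaleC c x + scaleC d x"
    and scaleC_scaleC: "scaleC c (scaleC d x) = scaleC (c * d) x"
    and scaleC_of_real: "scaleC (of_real r) x = scaleR r x"
    and cinner_commute: "cinner x y = cnj (cinner y x)"
    and cinner_add_left: "cinner (x + y) z = cinner x z + cinner y z"
    and cinner_scaleC_left: "cinner (scaleC c x) y = c * cinner x y"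
    and inner_eq_Re_cinner: "inner x y = Re (cinner x y)"

instantiation complex :: complex_inner
begin
definition scaleC_complex :: "complex \<Rightarrow> complex \<Rightarrow> complex"
  where "scaleC_complex c x = c * x"
definition cinner_complex :: "complex \<Rightarrow> complex \<Rightarrow> complex"
  where "cinner_complex x y = x * cnj y"
instance
  by standard
    (auto simp: scaleC_complex_def cinner_complex_def algebra_simps scaleR_conv_of_real
      inner_complex_def)
end

instantiation vec :: (complex_inner, finite) complex_inner
begin
definition scaleC_vec :: "complex \<Rightarrow> 'a ^ 'b \<Rightarrow> 'a ^ 'b"
  where "scaleC_vec c x = (\<chi> i. scaleC c (x $ i))"
definition cinner_vec :: "'a ^ 'b \<Rightarrow> 'a ^ 'b \<Rightarrow> complex"
  where "cinner_vec x y = (\<Sum>i\<in>UNIV. cinner (x $ i) (y $ i))"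
instance
proof
  fix x y :: "'a ^ 'b"
  have "cinner (x $ i) (y $ i) = cnj (cinner (y $ i) (x $ i))" for i
    by (rule cinner_commute)
  then show "cinner x y = cnj (cinner y x)"
    unfolding cinner_vec_def cnj_sum by (intro sum.cong) auto
qed (auto simp: scaleC_vec_def cinner_vec_def vec_eq_iff scaleC_add_right scaleC_add_left
      scaleC_scaleC scaleC_of_real cinner_add_left cinner_scaleC_left sum.distrib
      sum_distrib_left inner_vec_def inner_eq_Re_cinner)
end

definition clinear_on :: "'a::complex_inner set \<Rightarrow> ('a \<Rightarrow> 'b::complex_inner) \<Rightarrow> bool"
  where "clinear_on K W \<longleftrightarrow>
    (\<forall>x\<in>K. \<forall>y\<in>K. W (x + y) = W x + W y) \<and> (\<forall>c. \<forall>x\<in>K. W (scaleC c x) = scaleC c (W x))"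

definition hilbert_subspace :: "'a::complex_inner set \<Rightarrow> bool"
  where "hilbert_subspace K \<longleftrightarrow> module.subspace scaleC K \<and> complete K"

definition orth_proj :: "'a::complex_inner set \<Rightarrow> 'a \<Rightarrow> 'a"
  where "orth_proj M x = (THE y. y \<in> M \<and> (\<forall>h\<in>M. cinner (x - y) h = 0))"


section \<open>Isometric and unitary dilations\<close>

text \<open>An operator on a Hilbert space \<open>K\<close> that is a subspace of an ambient type is given by a
  function on that type, of which only the restriction to \<open>K\<close> matters. The inclusion
  \<open>H \<subseteq> K\<close> is given by an isometric embedding \<open>J\<close> of the (complete) type of \<open>H\<close>.\<close>

definition isometry_on :: "'a::complex_inner set \<Rightarrow> ('a \<Rightarrow> 'b::complex_inner) \<Rightarrow> bool"
  where "isometry_on K W \<longleftrightarrow> clinear_on K W \<and> (\<forall>x\<in>K. norm (W x) = norm x)"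

definition is_dilation ::
    "('h::{complex_inner,complete_space} \<Rightarrow> 'k::complex_inner) \<Rightarrow> ('h \<Rightarrow> 'h) \<Rightarrow> 'k set \<Rightarrow> ('k \<Rightarrow> 'k) \<Rightarrow> bool"
  where "is_dilation J S K W \<longleftrightarrow>
    clinear_on UNIV S \<and> bounded_linear S \<and> onorm S \<le> 1 \<and>
    hilbert_subspace K \<and> isometry_on UNIV J \<and> range J \<subseteq> K \<and>
    (\<forall>k h. J ((S ^^ k) h) = orth_proj (range J) ((W ^^ k) (J h)))"

definition isometric_dilation ::
    "('h::{complex_inner,complete_space} \<Rightarrow> 'k::complex_inner) \<Rightarrow> ('h \<Rightarrow> 'h) \<Rightarrow> 'k set \<Rightarrow> ('k \<Rightarrow> 'k) \<Rightarrow> bool"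
  where "isometric_dilation J S K W \<longleftrightarrow>
    is_dilation J S K W \<and> isometry_on K W \<and> W ` K \<subseteq> K"

definition unitary_dilation ::
    "('h::{complex_inner,complete_space} \<Rightarrow> 'k::complex_inner) \<Rightarrow> ('h \<Rightarrow> 'h) \<Rightarrow> 'k set \<Rightarrow> ('k \<Rightarrow> 'k) \<Rightarrow> bool"
  where "unitary_dilation J S K W \<longleftrightarrow>
    is_dilation J S K W \<and> isometry_on K W \<and> W ` K = K"

definition int_iterate :: "'a set \<Rightarrow> ('a \<Rightarrow> 'a) \<Rightarrow> int \<Rightarrow> 'a \<Rightarrow> 'a"
  where "int_iterate K W m =
    (if m \<ge> 0 then W ^^ nat m else inv_into K W ^^ nat (- m))"

definition minimal_isometric_dilation ::
    "('h::{complex_inner,complete_space} \<Rightarrow> 'k::complex_inner) \<Rightarrow> ('h \<Rightarrow> 'h) \<Rightarrow> 'k set \<Rightarrow> ('k \<Rightarrow> 'k) \<Rightarrow> bool"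
  where "minimal_isometric_dilation J S K W \<longleftrightarrow>
    isometric_dilation J S K W \<and>
    K = closure (module.span scaleC {(W ^^ m) (J h) | m h. True})"

definition minimal_unitary_dilation ::
    "('h::{complex_inner,complete_space} \<Rightarrow> 'k::complex_inner) \<Rightarrow> ('h \<Rightarrow> 'h) \<Rightarrow> 'k set \<Rightarrow> ('k \<Rightarrow> 'k) \<Rightarrow> bool"
  where "minimal_unitary_dilation J S K W \<longleftrightarrow>
    unitary_dilation J S K W \<and>
    K = closure (module.span scaleC {int_iterate K W m (J h) | m h. True})"


section \<open>The space \<open>L\<^sup>2\<close> of vector-valued functions on the unit circle\<close>

text \<open>Normalised arc length, as a probability measure with space the unit circle.\<close>

definition circle_measure :: "complex measure"
  where "circle_measure =
    distr (uniform_measure lborel {0..2 * pi}) (restrict_space borel (sphere 0 1)) cis"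

definition square_integrable :: "(complex \<Rightarrow> complex ^ 'n) \<Rightarrow> bool"
  where "square_integrable f \<longleftrightarrow> f \<in> borel_measurable circle_measure \<and>
    integrable circle_measure (\<lambda>z. (norm (f z))\<^sup>2)"

lemma emeasure_circle_space: "emeasure circle_measure (space circle_measure) = 1"
proof -
  have m: "cis \<in> measurable (uniform_measure lborel {0..2 * pi}) (restrict_space borel (sphere 0 1))"
    by (intro measurable_restrict_space2)
      (auto simp: uniform_measure_def intro!: borel_measurable_continuous_onI continuous_intros)
  have top: "space (restrict_space borel (sphere 0 1)) = (sphere 0 1 :: complex set)"
    by (simp add: space_restrict_space)
  have "sphere 0 1 \<in> sets (restrict_space borel (sphere 0 1 :: complex set))"
    using sets.top[of "restrict_space borel (sphere 0 1 :: complex set)"] by (simp only: top)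
  moreover have "cis -` sphere 0 1 \<inter> space (uniform_measure lborel {0..2 * pi}) = UNIV"
    by auto
  moreover have "emeasure (uniform_measure lborel {0..2 * pi}) UNIV = 1"
    by (subst emeasure_uniform_measure) (auto simp: ennreal_divide_self)
  ultimately show ?thesis
    unfolding circle_measure_def space_distr top
    by (subst emeasure_distr[OF m]) (simp_all only:)
qed

lemma finite_measure_circle: "finite_measure circle_measure"
  by (rule finite_measureI) (simp add: emeasure_circle_space)

lemma square_integrable_const: "square_integrable (\<lambda>_. v)"
  using finite_measure_circle
  by (simp add: square_integrable_def finite_measure.integrable_const)

lemma square_integrable_scaleC:
  fixes f :: "complex \<Rightarrow> complex ^ 'n"
  assumes "square_integrable f"
  shows "square_integrable (\<lambda>z. scaleC c (f z))"
proof -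
  have lin: "bounded_linear (scaleC c :: complex ^ 'n \<Rightarrow> _)"
    by (intro linear_conv_bounded_linear[THEN iffD1] linearI)
      (auto simp: vec_eq_iff scaleC_vec_def scaleC_complex_def algebra_simps)
  have "(norm (scaleC c x))\<^sup>2 = (norm c)\<^sup>2 * (norm x)\<^sup>2" for x :: "complex ^ 'n"
    by (simp add: norm_vec_def scaleC_vec_def scaleC_complex_def norm_mult L2_set_def
        power_mult_distrib sum_distrib_left sum_nonneg)
  then show ?thesis
    using assms borel_measurable_continuous_on[OF linear_continuous_on[OF lin], of f]
    by (simp add: square_integrable_def)
qed

lemma square_integrable_add:
  assumes "square_integrable f" "square_integrable g"
  shows "square_integrable (\<lambda>z. f z + g z)"
proof -
  have [measurable]: "f \<in> borel_measurable circle_measure" "g \<in> borel_measurable circle_measure"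
    using assms by (auto simp: square_integrable_def)
  have le: "(norm (f z + g z))\<^sup>2 \<le> 2 * (norm (f z))\<^sup>2 + 2 * (norm (g z))\<^sup>2" for z
  proof -
    have "(norm (f z + g z))\<^sup>2 \<le> (norm (f z) + norm (g z))\<^sup>2"
      by (intro power_mono norm_triangle_ineq) simp
    then show ?thesis
      using sum_squares_bound[of "norm (f z)" "norm (g z)"] by (simp add: power2_sum)
  qed
  have "integrable circle_measure (\<lambda>z. (norm (f z + g z))\<^sup>2)"
  proof (rule Bochner_Integration.integrable_bound)
    show "integrable circle_measure (\<lambda>z. 2 * (norm (f z))\<^sup>2 + 2 * (norm (g z))\<^sup>2)"
      using assms by (auto simp: square_integrable_def)
    show "(\<lambda>z. (norm (f z + g z))\<^sup>2) \<in> borel_measurable circle_measure"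
      by measurable
    show "AE z in circle_measure. norm ((norm (f z + g z))\<^sup>2)
        \<le> norm (2 * (norm (f z))\<^sup>2 + 2 * (norm (g z))\<^sup>2)"
      using le by (intro AE_I2) (metis abs_of_nonneg order_trans real_norm_def zero_le_power2)
  qed
  then show ?thesis
    by (simp add: square_integrable_def)
qed

lemma square_integrable_uminus:
  "square_integrable f \<Longrightarrow> square_integrable (\<lambda>z. - f z)"
  by (auto simp: square_integrable_def)

lemma square_integrable_diff:
  "square_integrable f \<Longrightarrow> square_integrable g \<Longrightarrow> square_integrable (\<lambda>z. f z - g z)"
  using square_integrable_add[of f "\<lambda>z. - g z"] square_integrable_uminus[of g] by simp

lemma integrable_cinner:
  fixes f g :: "complex \<Rightarrow> complex ^ 'n"
  assumes "square_integrable f" "square_integrable g"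
  shows "integrable circle_measure (\<lambda>z. cinner (f z) (g z))"
proof -
  have [measurable]: "f \<in> borel_measurable circle_measure" "g \<in> borel_measurable circle_measure"
    using assms by (auto simp: square_integrable_def)
  have comp: "integrable circle_measure (\<lambda>z. f z $ i * cnj (g z $ i))" for i
  proof (rule Bochner_Integration.integrable_bound)
    show "integrable circle_measure (\<lambda>z. (norm (f z))\<^sup>2 + (norm (g z))\<^sup>2)"
      using assms by (auto simp: square_integrable_def)
    have [measurable]: "(\<lambda>z. f z $ i) \<in> borel_measurable circle_measure"
      "(\<lambda>z. cnj (g z $ i)) \<in> borel_measurable circle_measure"
      by (auto intro!: borel_measurable_continuous_on[where f = "\<lambda>v::complex^'n. v $ i"]
          borel_measurable_continuous_on[where f = "\<lambda>v::complex^'n. cnj (v $ i)"] continuous_intros)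
    show "(\<lambda>z. f z $ i * cnj (g z $ i)) \<in> borel_measurable circle_measure"
      by measurable
    have "norm (f z $ i * cnj (g z $ i)) \<le> (norm (f z))\<^sup>2 + (norm (g z))\<^sup>2" for z
    proof -
      have "norm (f z $ i * cnj (g z $ i)) \<le> norm (f z) * norm (g z)"
        by (simp add: norm_mult mult_mono Finite_Cartesian_Product.norm_nth_le)
      also have "\<dots> \<le> (norm (f z))\<^sup>2 + (norm (g z))\<^sup>2"
        using sum_squares_bound[of "norm (f z)" "norm (g z)"]
          mult_nonneg_nonneg[of "norm (f z)" "norm (g z)"] by (simp del: mult_nonneg_nonneg)
      finally show ?thesis .
    qed
    then show "AE z in circle_measure. norm (f z $ i * cnj (g z $ i))
        \<le> norm ((norm (f z))\<^sup>2 + (norm (g z))\<^sup>2)"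
      by auto
  qed
  show ?thesis
    unfolding cinner_vec_def cinner_complex_def by (intro Bochner_Integration.integrable_sum comp)
qed

quotient_type 'n L2 = "complex \<Rightarrow> complex ^ 'n" / partial:
  "\<lambda>f g. square_integrable f \<and> square_integrable g \<and> (AE z in circle_measure. f z = g z)"
proof (rule part_equivpI)
  show "\<exists>f :: complex \<Rightarrow> complex ^ 'n. square_integrable f \<and> square_integrable f \<and>
      (AE z in circle_measure. f z = f z)"
    using square_integrable_const[of 0] by auto
qed (auto simp: symp_def transp_def elim!: AE_mp)

instantiation L2 :: (finite) complex_inner
begin

lift_definition zero_L2 :: "'a L2" is "\<lambda>_. 0"
  by (simp add: square_integrable_const)

lift_definition plus_L2 :: "'a L2 \<Rightarrow> 'a L2 \<Rightarrow> 'a L2" is "\<lambda>f g z. f z + g z"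
  by (auto simp: square_integrable_add elim!: AE_mp)

lift_definition minus_L2 :: "'a L2 \<Rightarrow> 'a L2 \<Rightarrow> 'a L2" is "\<lambda>f g z. f z - g z"
  by (auto simp: square_integrable_diff elim!: AE_mp)

lift_definition uminus_L2 :: "'a L2 \<Rightarrow> 'a L2" is "\<lambda>f z. - f z"
  by (auto simp: square_integrable_uminus elim!: AE_mp)

lift_definition scaleC_L2 :: "complex \<Rightarrow> 'a L2 \<Rightarrow> 'a L2" is "\<lambda>c f z. scaleC c (f z)"
  by (auto simp: square_integrable_scaleC elim!: AE_mp)

lift_definition cinner_L2 :: "'a L2 \<Rightarrow> 'a L2 \<Rightarrow> complex"
  is "\<lambda>f g. \<integral>z. cinner (f z) (g z) \<partial>circle_measure"
proof -
  fix f f' g g' :: "complex \<Rightarrow> complex ^ 'a"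
  assume f: "square_integrable f \<and> square_integrable f' \<and> (AE z in circle_measure. f z = f' z)"
    and g: "square_integrable g \<and> square_integrable g' \<and> (AE z in circle_measure. g z = g' z)"
  show "(\<integral>z. cinner (f z) (g z) \<partial>circle_measure) = (\<integral>z. cinner (f' z) (g' z) \<partial>circle_measure)"
    using f g integrable_cinner[of f g] integrable_cinner[of f' g']
    by (intro integral_cong_AE borel_measurable_integrable) (auto elim!: AE_mp)
qed

definition scaleR_L2 :: "real \<Rightarrow> 'a L2 \<Rightarrow> 'a L2"
  where "scaleR_L2 r = scaleC (of_real r)"

definition inner_L2 :: "'a L2 \<Rightarrow> 'a L2 \<Rightarrow> real"
  where "inner_L2 x y = Re (cinner x y)"

definition norm_L2 :: "'a L2 \<Rightarrow> real"
  where "norm_L2 x = sqrt (inner x x)"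

definition sgn_L2 :: "'a L2 \<Rightarrow> 'a L2"
  where "sgn_L2 x = scaleR (inverse (norm x)) x"

definition dist_L2 :: "'a L2 \<Rightarrow> 'a L2 \<Rightarrow> real"
  where "dist_L2 x y = norm (x - y)"

definition uniformity_L2 :: "('a L2 \<times> 'a L2) filter"
  where "uniformity_L2 = (INF e\<in>{0 <..}. principal {(x, y). dist x y < e})"

definition open_L2 :: "'a L2 set \<Rightarrow> bool"
  where "open_L2 U \<longleftrightarrow> (\<forall>x\<in>U. eventually (\<lambda>(x', y). x' = x \<longrightarrow> y \<in> U) uniformity)"

instance
proof
  fix x y z :: "'a L2" and c d :: complex and r s :: real
  show "x + y + z = x + (y + z)"
    by transfer (auto simp: square_integrable_add add.assoc)
  show "x + y = y + x"
    by transfer (auto simp: square_integrable_add add.commute)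
  show "0 + x = x"
    by transfer auto
  show "- x + x = 0"
    by transfer (auto simp: square_integrable_const)
  show "x - y = x + - y"
    by transfer (auto simp: square_integrable_diff)
  show addr: "scaleC c (x + y) = scaleC c x + scaleC c y" for c and x y :: "'a L2"
    by transfer (auto simp: square_integrable_add square_integrable_scaleC scaleC_add_right)
  show addl: "scaleC (c + d) x = scaleC c x + scaleC d x" for c d and x :: "'a L2"
    by transfer (auto simp: square_integrable_add square_integrable_scaleC scaleC_add_left)
  show assoc: "scaleC c (scaleC d x) = scaleC (c * d) x" for c d and x :: "'a L2"
    by transfer (auto simp: square_integrable_scaleC scaleC_scaleC)
  show scR: "scaleC (of_real r) x = scaleR r x"
    by (simp add: scaleR_L2_def)
  show "scaleR r (x + y) = scaleR r x + scaleR r y"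
    "scaleR (r + s) x = scaleR r x + scaleR s x" "scaleR r (scaleR s x) = scaleR (r * s) x"
    by (simp_all add: scaleR_L2_def addr addl assoc)
  have "scaleC 1 x = x"
    by transfer (auto simp: square_integrable_scaleC scaleC_of_real[of 1, simplified])
  then show "scaleR 1 x = x"
    by (simp add: scaleR_L2_def)
  show comm: "cinner x y = cnj (cinner y x)" for x y :: "'a L2"
  proof transfer
    fix x y :: "complex \<Rightarrow> complex ^ 'a"
    have "(\<integral>z. cinner (x z) (y z) \<partial>circle_measure)
        = (\<integral>z. cnj (cinner (y z) (x z)) \<partial>circle_measure)"
      by (intro Bochner_Integration.integral_cong refl cinner_commute)
    then show "(\<integral>z. cinner (x z) (y z) \<partial>circle_measure)
        = cnj (\<integral>z. cinner (y z) (x z) \<partial>circle_measure)"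
      by (simp only: Bochner_Integration.integral_cnj)
  qed
  show cadd: "cinner (x + y) z = cinner x z + cinner y z" for x y z :: "'a L2"
    by transfer (simp add: cinner_add_left integrable_cinner)
  show csc: "cinner (scaleC c x) y = c * cinner x y" for c and x y :: "'a L2"
    by transfer (simp add: cinner_scaleC_left)
  show "inner x y = Re (cinner x y)"
    by (simp add: inner_L2_def)
  show "inner x y = inner y x"
    by (simp add: inner_L2_def comm[of x y])
  show "inner (x + y) z = inner x z + inner y z" "inner (scaleR r x) y = r * inner x y"
    by (simp_all add: inner_L2_def scaleR_L2_def cadd csc)
  have nonneg_zero: "0 \<le> Re (cinner x x) \<and> (Re (cinner x x) = 0 \<longleftrightarrow> x = 0)"
  proof transfer
    fix f :: "complex \<Rightarrow> complex ^ 'a"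
    assume "square_integrable f \<and> square_integrable f \<and> (AE z in circle_measure. f z = f z)"
    then have f: "square_integrable f" by simp
    have "Re (\<integral>z. cinner (f z) (f z) \<partial>circle_measure)
        = (\<integral>z. (norm (f z))\<^sup>2 \<partial>circle_measure)"
      by (subst integral_Re[symmetric])
        (auto simp: integrable_cinner f power2_norm_eq_inner inner_eq_Re_cinner)
    moreover have "(\<integral>z. (norm (f z))\<^sup>2 \<partial>circle_measure) = 0 \<longleftrightarrow> (AE z in circle_measure. f z = 0)"
      using f by (subst integral_nonneg_eq_0_iff_AE) (auto simp: square_integrable_def)
    ultimately show "0 \<le> Re (\<integral>z. cinner (f z) (f z) \<partial>circle_measure) \<and>
      (Re (\<integral>z. cinner (f z) (f z) \<partial>circle_measure) = 0 \<longleftrightarrow>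
        square_integrable f \<and> square_integrable (\<lambda>_. 0 :: complex ^ 'a) \<and>
        (AE z in circle_measure. f z = 0))"
      using f by (simp add: square_integrable_const)
  qed
  then show "0 \<le> inner x x" "inner x x = 0 \<longleftrightarrow> x = 0"
    by (simp_all add: inner_L2_def)
  show "norm x = sqrt (inner x x)" "dist x y = norm (x - y)" "sgn x = scaleR (inverse (norm x)) x"
    by (simp_all add: norm_L2_def dist_L2_def sgn_L2_def)
qed (simp_all add: uniformity_L2_def open_L2_def)

end

lift_definition const_L2 :: "complex ^ 'n \<Rightarrow> 'n L2" is "\<lambda>v _. v"
  by (simp add: square_integrable_const)

text \<open>Multiplication by a matrix function. The choice of representative is irrelevant, and
  the product is again square integrable, if \<open>A\<close> is measurable and bounded on the circle.\<close>

definition mult_op :: "(complex \<Rightarrow> complex ^ 'n ^ 'n) \<Rightarrow> 'n::finite L2 \<Rightarrow> 'n L2"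
  where "mult_op A f = abs_L2 (\<lambda>z. A z *v rep_L2 f z)"


section \<open>The vector-valued Hardy space\<close>

text \<open>\<open>hardy_space\<close> consists of the boundary values on the circle (limits in \<open>L\<^sup>2\<close> of the
  dilates \<open>z \<mapsto> F (r z)\<close> as \<open>r \<rightarrow> 1\<close>) of the functions \<open>F\<close> in the Hardy class of the disk.\<close>

definition hardy_class :: "(complex \<Rightarrow> complex ^ 'n) set"
  where "hardy_class = {F. (\<forall>i. (\<lambda>z. F z $ i) holomorphic_on ball 0 1) \<and>
    (\<exists>C. \<forall>r. 0 \<le> r \<and> r < 1 \<longrightarrow>
      (\<integral>z. (norm (F (of_real r * z)))\<^sup>2 \<partial>circle_measure) \<le> C)}"

definition hardy_space :: "'n::finite L2 set"
  where "hardy_space = {f. \<exists>F\<in>hardy_class.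
    ((\<lambda>r::real. abs_L2 (\<lambda>z. F (of_real r * z))) \<longlongrightarrow> f) (at_left 1)}"


section \<open>Nelson dilations\<close>

definition adjoint_matrix :: "complex ^ 'n ^ 'm \<Rightarrow> complex ^ 'm ^ 'n"
  where "adjoint_matrix A = (\<chi> i j. cnj (A $ j $ i))"

definition unitary_matrix :: "complex ^ 'n ^ 'n \<Rightarrow> bool"
  where "unitary_matrix U \<longleftrightarrow>
    U ** adjoint_matrix U = mat 1 \<and> adjoint_matrix U ** U = mat 1"

definition diag_matrix :: "('n \<Rightarrow> complex) \<Rightarrow> complex ^ 'n ^ 'n"
  where "diag_matrix d = (\<chi> i j. if i = j then d i else 0)"

definition disk_aut :: "complex \<Rightarrow> complex \<Rightarrow> complex \<Rightarrow> complex"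
  where "disk_aut l a z = l * ((z + a) / (1 + cnj a * z))"

text \<open>The values of a Nelson dilation outside the closed unit disk are left unspecified.\<close>

definition nelson_dilation :: "complex ^ 'n ^ 'n \<Rightarrow> (complex \<Rightarrow> complex ^ 'n ^ 'n) \<Rightarrow> bool"
  where "nelson_dilation T That \<longleftrightarrow>
    (\<exists>U V s l a. unitary_matrix U \<and> unitary_matrix V \<and>
      (\<forall>i. s i \<in> ball 0 1) \<and> T = U ** diag_matrix s ** adjoint_matrix V \<and>
      (\<forall>i. l i \<in> sphere 0 1 \<and> a i \<in> ball 0 1 \<and> disk_aut (l i) (a i) 0 = s i) \<and>
      (\<forall>z\<in>cball 0 1. That z =
        U ** diag_matrix (\<lambda>i. disk_aut (l i) (a i) z) ** adjoint_matrix V))"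

end

theory Submission
  imports Defs "HOL-Computational_Algebra.Polynomial" "HOL-Complex_Analysis.Cauchy_Integral_Formula"
begin

text \<open>Let \<open>Z\<close> be the shift (multiplication by \<open>z\<close>), \<open>W\<close> the multiplication by the Nelson dilation,
  \<open>J\<close> the inclusion of the constants, and \<open>u\<^sub>i\<close>, \<open>v\<^sub>i\<close> the columns of \<open>U\<close>, \<open>V\<close>. Everything about \<open>W\<close>
  follows from the relation \<open>(1 + cnj a\<^sub>i Z) W J v\<^sub>i = l\<^sub>i (Z + a\<^sub>i) J u\<^sub>i\<close>. Let \<open>H\<close> be the space of all \<open>f\<close>
  whose negative Fourier coefficients vanish. For \<open>f\<close> in \<open>H\<close> the relation turns the negative
  coefficients of \<open>W f\<close> into a recursion whose only bounded solution is zero, so \<open>W H \<subseteq> H\<close>, and it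
  shows that \<open>W\<close> acts as \<open>T\<close> on the zeroth coefficient; this is the dilation property.

  If \<open>f\<close> in \<open>H\<close> is orthogonal to all \<open>W\<^sup>m J h\<close>, the relation shows that \<open>W\<^sup>-\<^sup>1 f\<close> is again such a
  vector, hence \<open>f\<close> lies in \<open>W\<^sup>k H\<close> for all \<open>k\<close>. For every such \<open>f\<close> the zeroth coefficient is bounded
  by \<open>\<parallel>T\<parallel>\<^sup>k \<parallel>f\<parallel>\<close> and so vanishes; therefore \<open>Z\<^sup>-\<^sup>1 f\<close> again lies in all \<open>W\<^sup>k H\<close>, all coefficients of
  \<open>f\<close> vanish, and \<open>f = 0\<close>. Replacing \<open>Z\<close>, \<open>W\<close>, \<open>T\<close> by \<open>Z\<^sup>-\<^sup>1\<close>, \<open>W\<^sup>-\<^sup>1\<close>, \<open>T\<^sup>*\<close> treats the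
  antianalytic half, and both halves together span \<open>L\<^sup>2\<close>.\<close>

section \<open>Orthogonal projections\<close>

text \<open>Subspaces and spans over the complex scalars become available as
  \<open>cmod.subspace\<close> and \<open>cmod.span\<close>, which are the
  \<open>module.subspace scaleC\<close> and \<open>module.span scaleC\<close> of the
  statement.\<close>

interpretation cmod: module "scaleC :: complex \<Rightarrow> 'a::complex_inner \<Rightarrow> 'a"
  by unfold_locales
    (auto simp: scaleC_add_right scaleC_add_left scaleC_scaleC scaleC_of_real[of 1, simplified])

lemma cinner_add_right: "cinner x (y + z) = cinner x y + cinner x z"
  using cinner_add_left[of y z x] by (metis cinner_commute complex_cnj_add)

lemma cinner_scaleC_right: "cinner x (scaleC c y) = cnj c * cinner x y"
  using cinner_scaleC_left[of c y x] by (metis cinner_commute complex_cnj_mult)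

lemma cinner_zero_left [simp]: "cinner 0 y = 0"
  using cinner_scaleC_left[of 0 0 y] cmod.scale_zero_right by (simp add: cmod.scale_zero_left)

lemma cinner_zero_right [simp]: "cinner x 0 = 0"
  using cinner_commute[of x 0] by simp

lemma cinner_minus_left: "cinner (- x) y = - cinner x y"
  using cinner_add_left[of x "- x" y] by (simp add: add_eq_0_iff)

lemma cinner_diff_left: "cinner (x - y) z = cinner x z - cinner y z"
  using cinner_add_left[of x "- y" z] by (simp add: cinner_minus_left)

lemma cinner_sum_left: "cinner (sum f A) y = (\<Sum>i\<in>A. cinner (f i) y)"
  by (induction A rule: infinite_finite_induct) (auto simp: cinner_add_left)

lemma cinner_sum_right: "cinner x (sum f A) = (\<Sum>i\<in>A. cinner x (f i))"
  by (induction A rule: infinite_finite_induct) (auto simp: cinner_add_right)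

lemma cinner_self: "cinner x x = of_real ((norm x)\<^sup>2)"
proof (rule complex_eqI)
  show "Re (cinner x x) = Re (of_real ((norm x)\<^sup>2))"
    by (simp add: inner_eq_Re_cinner[symmetric] power2_norm_eq_inner)
  show "Im (cinner x x) = Im (of_real ((norm x)\<^sup>2))"
    using cinner_commute[of x x] by (metis Im_complex_of_real Reals_cnj_iff complex_is_Real_iff)
qed

lemma cinner_eqI:
  assumes "\<And>z. cinner x z = cinner y z"
  shows "x = y"
proof -
  have "cinner (x - y) (x - y) = 0"
    using assms by (simp add: cinner_diff_left)
  then show ?thesis
    by (simp add: cinner_self)
qed

lemma norm_scaleC: "norm (scaleC c x) = norm c * norm x"
proof -
  have "complex_of_real ((norm (scaleC c x))\<^sup>2) = of_real ((norm c * norm x)\<^sup>2)"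
    by (simp add: cinner_self[symmetric] cinner_scaleC_left cinner_scaleC_right
        power_mult_distrib mult.assoc[symmetric] del: of_real_power)
      (simp add: complex_norm_square[of c, simplified] cinner_self mult.commute[of "cnj c"])
  then have "(norm (scaleC c x))\<^sup>2 = (norm c * norm x)\<^sup>2"
    using of_real_eq_iff by blast
  then show ?thesis
    by (simp add: power2_eq_iff_nonneg)
qed

text \<open>Multiplying \<open>x\<close> by a unimodular phase makes the complex inner product equal
  to its modulus, and the real inequality then applies to its real part.\<close>

lemma cinner_Cauchy_Schwarz: "norm (cinner x y) \<le> norm x * norm y"
proof (cases "cinner x y = 0")
  case False
  define c where "c = cnj (cinner x y) / norm (cinner x y)"
  have "c * cinner x y = (cinner x y * cnj (cinner x y)) / norm (cinner x y)"
    by (simp add: c_def)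
  then have "c * cinner x y = norm (cinner x y)"
    using False by (simp add: complex_norm_square[symmetric] power2_eq_square)
  moreover have "norm c = 1"
    using False by (simp add: c_def norm_divide)
  ultimately have "norm (cinner x y) = inner (scaleC c x) y"
    by (simp add: inner_eq_Re_cinner cinner_scaleC_left)
  also have "\<dots> \<le> norm (scaleC c x) * norm y"
    by (rule norm_cauchy_schwarz)
  finally show ?thesis
    using \<open>norm c = 1\<close> by (simp add: norm_scaleC)
qed auto

lemma bounded_linear_cinner_left: "bounded_linear (\<lambda>x. cinner x y)"
  by (rule bounded_linear_intro[where K = "norm y"])
    (auto simp: cinner_add_left cinner_scaleC_left[of "of_real _", unfolded scaleC_of_real]
      scaleR_conv_of_real cinner_Cauchy_Schwarz)

lemma bounded_linear_scaleC: "bounded_linear (\<lambda>x. scaleC c x)"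
  by (rule bounded_linear_intro[where K = "norm c"])
    (auto simp: scaleC_add_right scaleC_of_real[symmetric] scaleC_scaleC norm_scaleC mult.commute)

lemma closed_cinner_zero: "closed {x. cinner x y = 0}"
  by (intro closed_Collect_eq continuous_on_const linear_continuous_on bounded_linear_cinner_left)

lemma subspace_closure:
  fixes S :: "'a::complex_inner set"
  assumes S: "cmod.subspace S"
  shows "cmod.subspace (closure S)"
proof (rule cmod.subspaceI)
  show "0 \<in> closure S"
    using cmod.subspace_0[OF S] closure_subset by blast
next
  fix x y assume "x \<in> closure S" "y \<in> closure S"
  then obtain f g where "\<And>n. f n \<in> S" "f \<longlonglongrightarrow> x" "\<And>n. g n \<in> S" "g \<longlonglongrightarrow> y"
    unfolding closure_sequential by auto
  then show "x + y \<in> closure S"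
    unfolding closure_sequential
    by (intro exI[of _ "\<lambda>n. f n + g n"]) (auto intro!: tendsto_add cmod.subspace_add[OF S])
next
  fix c and x assume "x \<in> closure S"
  then obtain f where "\<And>n. f n \<in> S" "f \<longlonglongrightarrow> x"
    unfolding closure_sequential by auto
  then show "scaleC c x \<in> closure S"
    unfolding closure_sequential
    by (intro exI[of _ "\<lambda>n. scaleC c (f n)"])
      (auto intro!: bounded_linear.tendsto[OF bounded_linear_scaleC] cmod.subspace_scale[OF S])
qed

text \<open>A minimizing sequence in \<open>M\<close> is Cauchy by the parallelogram law, and
  completeness provides its limit.\<close>

lemma ex_closest_in_subspace:
  fixes M :: "'a::real_inner set"
  assumes M: "complete M" "subspace M"
  shows "\<exists>p\<in>M. \<forall>m\<in>M. norm (x - p) \<le> norm (x - m)"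
proof -
  define D where "D = (\<lambda>m. (norm (x - m))\<^sup>2) ` M"
  define d where "d = Inf D"
  have D: "D \<noteq> {}" "bdd_below D"
    using subspace_0[OF M(2)] by (auto simp: D_def intro!: bdd_belowI[of _ 0])
  have dle: "d \<le> (norm (x - m))\<^sup>2" if "m \<in> M" for m
    using that D unfolding d_def by (intro cInf_lower) (auto simp: D_def)
  have "\<exists>m\<in>M. (norm (x - m))\<^sup>2 < d + inverse (real (Suc n))" for n
  proof -
    have "Inf D < d + inverse (real (Suc n))"
      by (simp add: d_def)
    then obtain y where "y \<in> D" "y < d + inverse (real (Suc n))"
      using cInf_lessD[OF D(1)] by blast
    then show ?thesis
      by (auto simp: D_def)
  qed
  then obtain m where m: "\<And>n. m n \<in> M" "\<And>n. (norm (x - m n))\<^sup>2 < d + inverse (real (Suc n))"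
    by metis
  \<comment> \<open>Parallelogram law for \<open>x - m i\<close> and \<open>x - m j\<close>: the
    midpoint lies in \<open>M\<close>, so its squared distance from \<open>x\<close> is at least
    \<open>d\<close>, while both sides are within \<open>1 / Suc i\<close> and
    \<open>1 / Suc j\<close> of \<open>d\<close>.\<close>
  have par: "(norm (m i - m j))\<^sup>2 \<le> 2 * inverse (real (Suc i)) + 2 * inverse (real (Suc j))" for i j
  proof -
    have "(1/2) *\<^sub>R (m i + m j) \<in> M"
      using m(1) M(2) by (auto simp: subspace_def)
    then have "d \<le> (norm (x - (1/2) *\<^sub>R (m i + m j)))\<^sup>2"
      by (rule dle)
    moreover have "(norm (m i - m j))\<^sup>2 + 4 * (norm (x - (1/2) *\<^sub>R (m i + m j)))\<^sup>2
        = 2 * (norm (x - m i))\<^sup>2 + 2 * (norm (x - m j))\<^sup>2"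
      by (simp add: power2_norm_eq_inner inner_diff_left inner_diff_right inner_add_left
          inner_add_right inner_commute algebra_simps)
    ultimately show ?thesis
      using m(2)[of i] m(2)[of j] by linarith
  qed
  have "Cauchy m"
  proof (rule metric_CauchyI)
    fix e :: real assume e: "e > 0"
    obtain N where N: "inverse (real (Suc N)) < e\<^sup>2 / 4"
      using reals_Archimedean[of "e\<^sup>2 / 4"] e by auto
    have "dist (m i) (m j) < e" if "i \<ge> N" "j \<ge> N" for i j
    proof -
      have "inverse (real (Suc i)) \<le> inverse (real (Suc N))"
        "inverse (real (Suc j)) \<le> inverse (real (Suc N))"
        using that by (auto intro!: le_imp_inverse_le)
      then have "(norm (m i - m j))\<^sup>2 < e\<^sup>2"
        using par[of i j] N by linarith
      then show ?thesis
        using e by (simp add: dist_norm power_less_imp_less_base)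
    qed
    then show "\<exists>N. \<forall>i\<ge>N. \<forall>j\<ge>N. dist (m i) (m j) < e"
      by blast
  qed
  then obtain p where p: "p \<in> M" "m \<longlonglongrightarrow> p"
    using M(1) m(1) unfolding complete_def by blast
  have "(norm (x - p))\<^sup>2 \<le> d"
  proof (rule LIMSEQ_le)
    show "(\<lambda>n. (norm (x - m n))\<^sup>2) \<longlonglongrightarrow> (norm (x - p))\<^sup>2"
      by (intro tendsto_intros p)
    show "(\<lambda>n. d + inverse (real (Suc n))) \<longlonglongrightarrow> d"
      using tendsto_add[OF tendsto_const LIMSEQ_inverse_real_of_nat, of d] by simp
  qed (use m(2) in \<open>auto intro: less_imp_le\<close>)
  then have "norm (x - p) \<le> norm (x - q)" if "q \<in> M" for q
    using dle[OF that] by (meson norm_ge_zero order_trans power2_le_imp_le)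
  then show ?thesis
    using p(1) by blast
qed

text \<open>The closest point works: moving it along \<open>m\<close> cannot shorten the distance,
  which kills the real part of the inner product; applying this to \<open>scaleC \<i> m\<close>
  kills the imaginary part.\<close>

lemma ex_orthogonal_projection:
  fixes M :: "'a::complex_inner set"
  assumes M: "complete M" "cmod.subspace M"
  shows "\<exists>p\<in>M. \<forall>m\<in>M. cinner (x - p) m = 0"
proof -
  have sub: "subspace M"
    using M(2) cmod.subspace_scale[OF M(2), of _ "of_real _"]
    by (auto simp: subspace_def cmod.subspace_def scaleC_of_real)
  obtain p where p: "p \<in> M" "\<And>m. m \<in> M \<Longrightarrow> norm (x - p) \<le> norm (x - m)"
    using ex_closest_in_subspace[OF M(1) sub, of x] by blast
  have re: "inner (x - p) m = 0" if m: "m \<in> M" for m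
  proof (cases "m = 0")
    case False
    \<comment> \<open>This \<open>t\<close> minimizes the quadratic
      \<open>t \<mapsto> (norm (x - p - t *\<^sub>R m))\<^sup>2\<close>.\<close>
    define t where "t = inner (x - p) m / inner m m"
    have pos: "inner m m > 0"
      using False by simp
    have "p + t *\<^sub>R m \<in> M"
      using p(1) m sub by (auto simp: subspace_def)
    then have "(norm (x - p))\<^sup>2 \<le> (norm (x - p - t *\<^sub>R m))\<^sup>2"
      using p(2) by (simp add: power_mono diff_diff_eq)
    also have "\<dots> = (norm (x - p))\<^sup>2 - 2 * t * inner (x - p) m + t\<^sup>2 * inner m m"
      by (simp only: power2_norm_eq_inner)
        (simp add: inner_diff_left inner_diff_right inner_commute power2_eq_square algebra_simps)
    also have "\<dots> = (norm (x - p))\<^sup>2 - (inner (x - p) m)\<^sup>2 / inner m m"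
      using pos by (simp add: t_def power2_eq_square field_simps)
    finally have "(inner (x - p) m)\<^sup>2 \<le> 0"
      using pos by (simp add: divide_le_0_iff)
    then show ?thesis
      by simp
  qed auto
  have "cinner (x - p) m = 0" if m: "m \<in> M" for m
  proof (rule complex_eqI)
    show "Re (cinner (x - p) m) = Re 0"
      using re[OF m] by (simp add: inner_eq_Re_cinner)
    have "inner (x - p) (scaleC \<i> m) = 0"
      using cmod.subspace_scale[OF M(2) m] by (rule re)
    then show "Im (cinner (x - p) m) = Im 0"
      by (simp add: inner_eq_Re_cinner cinner_scaleC_right)
  qed
  then show ?thesis
    using p(1) by blast
qed

text \<open>The definite description needs uniqueness: the difference of two candidates lies in
  \<open>M\<close> and is orthogonal to itself.\<close>

lemma orth_proj_eqI:
  assumes "cmod.subspace M" "y \<in> M" "\<And>h. h \<in> M \<Longrightarrow> cinner (x - y) h = 0"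
  shows "orth_proj M x = y"
  unfolding orth_proj_def
proof (rule the_equality)
  fix z assume z: "z \<in> M \<and> (\<forall>h\<in>M. cinner (x - z) h = 0)"
  then have "cinner (y - z) (y - z) = cinner (x - z) (y - z) - cinner (x - y) (y - z)"
    by (simp add: cinner_diff_left)
  also have "\<dots> = 0"
    using z assms cmod.subspace_diff[OF assms(1)] by simp
  finally show "z = y"
    by (simp add: cinner_self)
qed (use assms in auto)

section \<open>Dilations by a Moebius relation\<close>

text \<open>The assumption \<open>moebius\<close> says \<open>W J v\<^sub>i = b\<^sub>i(Z) J u\<^sub>i\<close> with the denominator of
  \<open>b\<^sub>i(z) = l\<^sub>i (z + a\<^sub>i) / (1 + cnj a\<^sub>i z)\<close> cleared.\<close>

locale dilation_pair =
  fixes J :: "complex ^ 'n \<Rightarrow> 'k::complex_inner" and Z Zi W Wi :: "'k \<Rightarrow> 'k"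
    and T :: "complex ^ 'n \<Rightarrow> complex ^ 'n" and q :: real
    and u v :: "'n \<Rightarrow> complex ^ 'n" and l a :: "'n \<Rightarrow> complex"
  assumes complete: "complete (UNIV :: 'k set)"
    and J: "isometry_on UNIV J"
    and linear: "clinear_on UNIV Z" "clinear_on UNIV Zi" "clinear_on UNIV W" "clinear_on UNIV Wi"
    and inverse: "\<And>x. Z (Zi x) = x" "\<And>x. Zi (Z x) = x" "\<And>x. W (Wi x) = x" "\<And>x. Wi (W x) = x"
    and adjoint: "\<And>x y. cinner (Z x) y = cinner x (Zi y)" "\<And>x y. cinner (W x) y = cinner x (Wi y)"
    and commute: "\<And>x. Z (W x) = W (Z x)"
    and wandering: "\<And>n x y. n > 0 \<Longrightarrow> cinner ((Z ^^ n) (J x)) (J y) = 0"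
    and total: "\<And>f. (\<And>n x. cinner f ((Z ^^ n) (J x)) = 0) \<Longrightarrow> (\<And>n x. cinner f ((Zi ^^ n) (J x)) = 0) \<Longrightarrow> f = 0"
    and moebius: "\<And>i. W (J (v i)) + scaleC (cnj (a i)) (Z (W (J (v i))))
      = scaleC (l i) (Z (J (u i)) + scaleC (a i) (J (u i)))"
    and a: "\<And>i. norm (a i) < 1" and l: "\<And>i. norm (l i) = 1"
    and u: "\<And>x. (\<Sum>i\<in>UNIV. scaleC (cinner x (u i)) (u i)) = x"
    and v: "\<And>x. (\<Sum>i\<in>UNIV. scaleC (cinner x (v i)) (v i)) = x"
    and T: "\<And>x i. cinner (T x) (u i) = l i * a i * cinner x (v i)"
    and contraction: "\<And>x. norm (T x) \<le> q * norm x" and q: "0 \<le> q" "q < 1"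
begin

section \<open>Algebra of the inclusion and of the four unitary operators\<close>

lemma J_add: "J (x + y) = J x + J y" and J_scaleC: "J (scaleC c x) = scaleC c (J x)"
  and norm_J: "norm (J x) = norm x"
  using J by (auto simp: isometry_on_def clinear_on_def)

lemma J_zero: "J 0 = 0"
  using norm_J[of 0] by simp

lemma J_sum: "J (sum g A) = (\<Sum>i\<in>A. J (g i))"
  by (induction A rule: infinite_finite_induct) (auto simp: J_add J_zero)

lemma add: "Z (x + y) = Z x + Z y" "Zi (x + y) = Zi x + Zi y" "W (x + y) = W x + W y"
    "Wi (x + y) = Wi x + Wi y"
  and scale: "Z (scaleC c x) = scaleC c (Z x)" "Zi (scaleC c x) = scaleC c (Zi x)"
    "W (scaleC c x) = scaleC c (W x)" "Wi (scaleC c x) = scaleC c (Wi x)"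
  using linear by (auto simp: clinear_on_def)

lemma adjoint': "cinner (Zi x) y = cinner x (Z y)" "cinner (Wi x) y = cinner x (W y)"
  using adjoint[of y x] by (metis cinner_commute)+

lemma commute': "Zi (W x) = W (Zi x)" "Z (Wi x) = Wi (Z x)" "Zi (Wi x) = Wi (Zi x)"
  by (metis commute inverse)+

lemma Zi_pow_add: "(Zi ^^ n) (x + y) = (Zi ^^ n) x + (Zi ^^ n) y"
  and Zi_pow_scale: "(Zi ^^ n) (scaleC c x) = scaleC c ((Zi ^^ n) x)"
  by (induction n) (auto simp: add scale)

lemma norm_iso: "norm (Z x) = norm x" "norm (Zi x) = norm x" "norm (W x) = norm x" "norm (Wi x) = norm x"
proof -
  have *: "norm y = norm x" if "cinner y y = cinner x x" for x y :: 'k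
    using that unfolding cinner_self of_real_eq_iff by (simp add: power2_eq_iff_nonneg)
  show "norm (Z x) = norm x" "norm (Zi x) = norm x" "norm (W x) = norm x" "norm (Wi x) = norm x"
    by (auto intro!: * simp: adjoint adjoint' inverse)
qed

lemma norm_pow: "norm ((Zi ^^ n) x) = norm x" "norm ((W ^^ n) x) = norm x" "norm ((Wi ^^ n) x) = norm x"
  by (induction n) (auto simp: norm_iso)

text \<open>Polarization turns the preservation of norms into that of real inner products; the
  imaginary part follows by replacing \<open>y\<close> with \<open>scaleC \<i> y\<close>.\<close>

lemma cinner_J: "cinner (J x) (J y) = cinner x y"
proof -
  have re: "Re (cinner (J x) (J y)) = Re (cinner x y)" for x y
    using norm_J[of "x + y"] norm_J[of x] norm_J[of y]
      dot_norm[of "J x" "J y"] dot_norm[of x y]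
    by (simp add: J_add[symmetric] inner_eq_Re_cinner[symmetric])
  show ?thesis
    using re[of x y] re[of x "scaleC \<i> y"]
    by (intro complex_eqI) (auto simp: J_scaleC cinner_scaleC_right)
qed

text \<open>Each of the families \<open>u\<close> and \<open>v\<close> expands every vector, so
  orthogonality can be tested on it. Both versions are needed because the Moebius relation controls
  \<open>W\<close> on the \<open>J (v i)\<close> and \<open>Wi\<close> on the
  \<open>J (u i)\<close>.\<close>

lemma cinner_J_u_zero: "(\<And>i. cinner f ((Zi ^^ n) (J (u i))) = 0) \<Longrightarrow> cinner f ((Zi ^^ n) (J x)) = 0"
  and cinner_J_v_zero: "(\<And>i. cinner f ((Zi ^^ n) (J (v i))) = 0) \<Longrightarrow> cinner f ((Zi ^^ n) (J x)) = 0"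
proof -
  have Zi0: "(Zi ^^ n) 0 = 0"
    using norm_pow(1)[of n 0] by simp
  have Zi_sum: "(Zi ^^ n) (sum g A) = (\<Sum>i\<in>A. (Zi ^^ n) (g i))" for g and A :: "'n set"
    by (induction A rule: infinite_finite_induct) (auto simp: Zi_pow_add Zi0)
  show "cinner f ((Zi ^^ n) (J x)) = 0" if "\<And>i. cinner f ((Zi ^^ n) (J (u i))) = 0"
    using that by (subst u[of x, symmetric])
      (simp add: J_sum Zi_sum cinner_sum_right J_scaleC Zi_pow_scale cinner_scaleC_right)
  show "cinner f ((Zi ^^ n) (J x)) = 0" if "\<And>i. cinner f ((Zi ^^ n) (J (v i))) = 0"
    using that by (subst v[of x, symmetric])
      (simp add: J_sum Zi_sum cinner_sum_right J_scaleC Zi_pow_scale cinner_scaleC_right)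
qed

section \<open>Vanishing negative coefficients and the zeroth coefficient\<close>

text \<open>The abstract Hardy space: all negative Fourier coefficients vanish. It is written
  through \<open>J\<close> and \<open>Zi\<close> alone, so that one set serves every
  \<open>W\<close>.\<close>

definition analytic :: "'k set"
  where "analytic = {f. \<forall>j>0. \<forall>x. cinner f ((Zi ^^ j) (J x)) = 0}"

text \<open>This is the adjoint of \<open>J\<close>, written out in the family \<open>u\<close>;
  \<open>cinner_coeff0\<close> is the adjoint relation.\<close>

definition coeff0 :: "'k \<Rightarrow> complex ^ 'n"
  where "coeff0 f = (\<Sum>i\<in>UNIV. scaleC (cinner f (J (u i))) (u i))"

lemma analyticD: "f \<in> analytic \<Longrightarrow> j > 0 \<Longrightarrow> cinner f ((Zi ^^ j) (J x)) = 0"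
  by (auto simp: analytic_def)

lemma closed_analytic: "closed analytic"
proof -
  have "analytic = (\<Inter>j\<in>{0<..}. \<Inter>x. {f. cinner f ((Zi ^^ j) (J x)) = 0})"
    by (auto simp: analytic_def)
  then show ?thesis
    by (auto intro!: closed_INT closed_cinner_zero)
qed

lemma subspace_analytic: "cmod.subspace analytic"
  by (rule cmod.subspaceI) (auto simp: analytic_def cinner_add_left cinner_scaleC_left)

lemma cinner_coeff0: "cinner (coeff0 f) x = cinner f (J x)"
proof -
  have "cinner f (J x) = (\<Sum>i\<in>UNIV. cnj (cinner x (u i)) * cinner f (J (u i)))"
    by (subst u[of x, symmetric]) (simp add: J_sum cinner_sum_right J_scaleC cinner_scaleC_right)
  also have "\<dots> = (\<Sum>i\<in>UNIV. cinner f (J (u i)) * cinner (u i) x)"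
    by (intro sum.cong refl) (simp add: cinner_commute[of x] mult.commute)
  finally show ?thesis
    by (simp add: coeff0_def cinner_sum_left cinner_scaleC_left)
qed

lemma coeff0_J: "coeff0 (J x) = x"
  by (rule cinner_eqI) (simp add: cinner_coeff0 cinner_J)

lemma norm_coeff0: "norm (coeff0 f) \<le> norm f"
proof (cases "coeff0 f = 0")
  case False
  have "(norm (coeff0 f))\<^sup>2 = norm (cinner (coeff0 f) (coeff0 f))"
    by (simp add: cinner_self norm_power)
  also have "\<dots> \<le> norm f * norm (coeff0 f)"
    using cinner_Cauchy_Schwarz[of f "J (coeff0 f)"] by (simp add: cinner_coeff0 norm_J)
  finally show ?thesis
    using False by (simp add: power2_eq_square)
qed auto

text \<open>Moving \<open>Zi ^^ j\<close> to the other side produces \<open>Z ^^ (n + j)\<close>,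
  and \<open>wandering\<close> applies as soon as \<open>j > 0\<close>.\<close>

lemma Z_pow_J_analytic: "(Z ^^ n) (J x) \<in> analytic"
proof -
  have "cinner ((Z ^^ n) (J x)) ((Zi ^^ j) (J y)) = cinner ((Z ^^ (n + j)) (J x)) (J y)" for j y
  proof (induction j arbitrary: n)
    case (Suc j)
    then show ?case
      using Suc[of "Suc n"] by (simp add: adjoint'[symmetric] adjoint(1)[symmetric])
  qed simp
  then show ?thesis
    by (auto simp: analytic_def wandering)
qed

lemma J_analytic: "J x \<in> analytic"
  using Z_pow_J_analytic[of 0] by simp

text \<open>Apply \<open>Wi\<close> and then \<open>Zi\<close> to \<open>moebius\<close>, and divide
  by the unimodular \<open>l i\<close>. The result has the form of \<open>moebius\<close> again,
  with \<open>Z\<close>, \<open>W\<close> replaced by their inverses, \<open>u\<close> and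
  \<open>v\<close> exchanged, and \<open>l\<close>, \<open>a\<close> conjugated.\<close>

lemma moebius_inverse: "Wi (J (u i)) + scaleC (a i) (Zi (Wi (J (u i))))
  = scaleC (cnj (l i)) (Zi (J (v i)) + scaleC (cnj (a i)) (J (v i)))"
proof -
  have l1: "cnj (l i) * l i = 1"
    using l[of i] complex_norm_square[of "l i"] by (simp add: mult.commute)
  have "J (v i) + scaleC (cnj (a i)) (Z (J (v i)))
      = scaleC (l i) (Z (Wi (J (u i))) + scaleC (a i) (Wi (J (u i))))"
    using arg_cong[OF moebius[of i], of Wi] by (simp add: add scale inverse commute'(2)[symmetric])
  then have "Zi (J (v i)) + scaleC (cnj (a i)) (J (v i))
      = scaleC (l i) (Wi (J (u i)) + scaleC (a i) (Zi (Wi (J (u i)))))"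
    using arg_cong[of _ _ Zi] by (metis add(2) scale(2) inverse(2))
  then show ?thesis
    by (simp add: scaleC_scaleC l1 scaleC_of_real[of 1, simplified])
qed

section \<open>Invariance under \<open>W\<close> and the action on the zeroth coefficient\<close>

text \<open>Testing \<open>f\<close> against \<open>moebius_inverse\<close> gives a two-term
  recursion for the coefficients of \<open>W f\<close>. At negative indices it is homogeneous with a
  factor of modulus less than 1, so boundedness leaves only zero; at index 0 it then reads off the
  action of \<open>T\<close>.\<close>

lemma
  assumes f: "f \<in> analytic"
  shows W_analytic: "W f \<in> analytic" and coeff0_W: "coeff0 (W f) = T (coeff0 f)"
proof -
  \<comment> \<open>By \<open>cW\<close> below, this is the component along \<open>u i\<close> of
    the coefficient of \<open>W f\<close> at index \<open>- j\<close>.\<close>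
  define x where "x j i = cinner f ((Zi ^^ j) (Wi (J (u i))))" for j i
  have rec: "x j i + cnj (a i) * x (Suc j) i
      = l i * (cinner f ((Zi ^^ Suc j) (J (v i))) + a i * cinner f ((Zi ^^ j) (J (v i))))" for j i
    using arg_cong[OF moebius_inverse[of i], of "\<lambda>y. cinner f ((Zi ^^ j) y)"]
    by (simp add: x_def Zi_pow_add Zi_pow_scale cinner_add_right cinner_scaleC_right funpow_swap1)
  have le: "norm (x j i) \<le> norm f * norm (u i)" for j i
    using cinner_Cauchy_Schwarz[of f "(Zi ^^ j) (Wi (J (u i)))"]
    by (simp add: x_def norm_pow norm_iso norm_J)
  \<comment> \<open>For \<open>j > 0\<close> both coefficients of \<open>f\<close> in
    \<open>rec\<close> vanish. The recursion is followed towards larger \<open>j\<close>, where the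
    values stay bounded by \<open>le\<close> while the factor \<open>norm (a i) ^ n\<close> tends to
    0.\<close>
  have eq: "norm (x j i) = norm (a i) ^ n * norm (x (j + n) i)" if "j > 0" for j i n
  proof (induction n)
    case (Suc n)
    have "x (j + n) i = - cnj (a i) * x (Suc (j + n)) i"
      using rec[of "j + n" i] that analyticD[OF f, of "Suc (j + n)"] analyticD[OF f, of "j + n"]
      by (simp add: add_eq_0_iff2)
    with Suc show ?case
      by (simp add: norm_mult)
  qed simp
  have bound: "norm (x j i) \<le> norm (a i) ^ n * (norm f * norm (u i))" if "j > 0" for j i n
    by (subst eq[OF that, of i n]) (intro mult_left_mono le zero_le_power norm_ge_zero)
  have x0: "x j i = 0" if "j > 0" for j i
  proof -
    have "(\<lambda>n. norm (a i) ^ n * (norm f * norm (u i))) \<longlonglongrightarrow> 0 * (norm f * norm (u i))"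
      using a by (intro tendsto_intros LIMSEQ_power_zero) simp
    then have "norm (x j i) \<le> 0 * (norm f * norm (u i))"
      by (rule LIMSEQ_le_const) (intro exI[of _ 0] allI impI bound that)
    then show ?thesis
      by simp
  qed
  have pow: "(Zi ^^ j) (Wi y) = Wi ((Zi ^^ j) y)" for j y
    by (induction j) (auto simp: commute')
  have cW: "cinner (W f) ((Zi ^^ j) (J (u i))) = x j i" for j i
    by (simp add: adjoint x_def pow)
  show "W f \<in> analytic"
    unfolding analytic_def by (intro CollectI allI impI, rule cinner_J_u_zero) (simp only: cW x0)
  \<comment> \<open>In \<open>rec\<close> at \<open>j = 0\<close> the terms of index
    \<open>- 1\<close> vanish for \<open>W f\<close> and for \<open>f\<close>; what remains is
    \<open>l i * a i * cinner f (J (v i))\<close>, which is how the assumption \<open>T\<close>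
    describes \<open>T (coeff0 f)\<close>.\<close>
  have "cinner (coeff0 (W f)) (u i) = cinner (T (coeff0 f)) (u i)" for i
    using rec[of 0 i] x0[of 1 i] cW[of 0 i] analyticD[OF f, of 1 "v i"]
    by (simp add: cinner_coeff0 T mult.assoc)
  then have "(\<Sum>i\<in>UNIV. scaleC (cinner (coeff0 (W f)) (u i)) (u i))
      = (\<Sum>i\<in>UNIV. scaleC (cinner (T (coeff0 f)) (u i)) (u i))"
    by simp
  then show "coeff0 (W f) = T (coeff0 f)"
    by (simp only: u)
qed

lemma coeff0_W_pow: "f \<in> analytic \<Longrightarrow> (W ^^ k) f \<in> analytic \<and> coeff0 ((W ^^ k) f) = (T ^^ k) (coeff0 f)"
  by (induction k) (auto simp: W_analytic coeff0_W)

section \<open>The intersection of the iterated images is trivial\<close>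

text \<open>As \<open>W\<close> is invertible with inverse \<open>Wi\<close>, this is the
  intersection of the images of \<open>analytic\<close> under all \<open>W ^^ k\<close>.\<close>

definition residual :: "'k set"
  where "residual = {f. \<forall>k. (Wi ^^ k) f \<in> analytic}"

text \<open>Writing \<open>f\<close> as \<open>(W ^^ k) g\<close> with \<open>g\<close> in
  \<open>analytic\<close> of the same norm gives \<open>coeff0 f = (T ^^ k) (coeff0 g)\<close>,
  which is at most \<open>q ^ k * norm f\<close>. Strictness of the contraction makes this tend to
  0.\<close>

lemma coeff0_residual:
  assumes "f \<in> residual"
  shows "coeff0 f = 0"
proof -
  have Tpow: "norm ((T ^^ k) x) \<le> q ^ k * norm x" for k x
  proof (induction k)
    case (Suc k)
    have "norm (T ((T ^^ k) x)) \<le> q * (q ^ k * norm x)"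
      by (rule order_trans[OF contraction mult_left_mono[OF Suc q(1)]])
    then show ?case
      by simp
  qed simp
  have inv: "(W ^^ k) ((Wi ^^ k) f) = f" for k
  proof (induction k)
    case (Suc k)
    have "(W ^^ Suc k) ((Wi ^^ Suc k) f) = (W ^^ k) (W (Wi ((Wi ^^ k) f)))"
      by (simp add: funpow_swap1)
    with Suc show ?case
      by (simp add: inverse)
  qed simp
  have bound: "norm (coeff0 f) \<le> q ^ k * norm f" for k
  proof -
    have "coeff0 f = (T ^^ k) (coeff0 ((Wi ^^ k) f))"
      using coeff0_W_pow[of "(Wi ^^ k) f" k] assms by (simp add: inv residual_def)
    also have "norm \<dots> \<le> q ^ k * norm (coeff0 ((Wi ^^ k) f))"
      by (rule Tpow)
    also have "\<dots> \<le> q ^ k * norm f"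
      using norm_coeff0[of "(Wi ^^ k) f"] q by (intro mult_left_mono) (auto simp: norm_pow)
    finally show ?thesis .
  qed
  have "(\<lambda>k. q ^ k * norm f) \<longlonglongrightarrow> 0 * norm f"
    using q by (intro tendsto_intros LIMSEQ_power_zero) simp
  then have "norm (coeff0 f) \<le> 0 * norm f"
    by (rule LIMSEQ_le_const) (intro exI[of _ 0] allI impI bound)
  then show ?thesis
    by simp
qed

text \<open>The backward shift moves the coefficient of index 0 to index -1, and
  \<open>coeff0_residual\<close> says that this coefficient is zero. Since \<open>Zi\<close>
  commutes with \<open>Wi\<close>, the argument applies to all \<open>(Wi ^^ k) f\<close>.\<close>

lemma Zi_residual: "f \<in> residual \<Longrightarrow> Zi f \<in> residual"
proof -
  assume f: "f \<in> residual"
  have "Zi g \<in> analytic" if g: "g \<in> residual" for g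
  proof -
    have "cinner (Zi g) ((Zi ^^ j) (J x)) = 0" if j: "j > 0" for j x
    proof -
      obtain m where m: "j = Suc m"
        using j by (auto simp: gr0_conv_Suc)
      have "cinner (Zi g) ((Zi ^^ j) (J x)) = cinner g ((Zi ^^ m) (J x))"
        by (simp add: m adjoint' inverse)
      also have "\<dots> = 0"
      \<comment> \<open>Only \<open>m = 0\<close> uses that the vector is residual beyond being
        analytic.\<close>
      proof (cases m)
        case 0
        then show ?thesis
          using coeff0_residual[OF g] cinner_coeff0[of g x] by simp
      next
        case (Suc m')
        have "g \<in> analytic"
          using g by (auto simp: residual_def dest: spec[of _ 0])
        then show ?thesis
          using Suc by (intro analyticD) auto
      qed
      finally show ?thesis .
    qed
    then show ?thesis
      by (auto simp: analytic_def)
  qed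
  moreover have "(Wi ^^ k) f \<in> residual" for k
  proof -
    have "(Wi ^^ j) ((Wi ^^ k) f) = (Wi ^^ (j + k)) f" for j
      by (simp add: funpow_add)
    then show ?thesis
      using f by (simp add: residual_def)
  qed
  moreover have "(Wi ^^ k) (Zi f) = Zi ((Wi ^^ k) f)" for k
    by (induction k) (auto simp: commute')
  ultimately show "Zi f \<in> residual"
    by (auto simp: residual_def)
qed

lemma cinner_Z_pow_shift: "cinner f ((Z ^^ n) g) = cinner ((Zi ^^ n) f) g"
proof (induction n arbitrary: f)
  case (Suc n)
  then show ?case
    using Suc[of "Zi f"] by (simp add: adjoint'(1)[symmetric] funpow_swap1[of Zi])
qed simp

text \<open>Shifting back repeatedly brings every coefficient of nonnegative index to position 0,
  where it vanishes; those of negative index vanish because \<open>f\<close> is analytic.\<close>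

lemma residual_zero:
  assumes "f \<in> residual"
  shows "f = 0"
proof (rule total)
  have "(Zi ^^ n) f \<in> residual" for n
    by (induction n) (auto simp: Zi_residual assms)
  then show Z: "cinner f ((Z ^^ n) (J x)) = 0" for n x
    using coeff0_residual[of "(Zi ^^ n) f"] cinner_coeff0[of "(Zi ^^ n) f" x]
    by (simp add: cinner_Z_pow_shift)
  show "cinner f ((Zi ^^ n) (J x)) = 0" for n x
  proof (cases n)
    case 0
    then show ?thesis
      using Z[of 0] by simp
  next
    case (Suc m)
    have "f \<in> analytic"
      using assms by (auto simp: residual_def dest: spec[of _ 0])
    then show ?thesis
      using Suc by (intro analyticD) auto
  qed
qed

section \<open>Density of the forward orbit and the compression\<close>

text \<open>Here the recursion for the coefficients of \<open>Wi f\<close> is solved away from index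
  0: orthogonality to \<open>W (J x)\<close> supplies the initial value 0, and orthogonality to
  \<open>J x\<close> makes the recursion homogeneous from its first step on.\<close>

lemma Wi_analytic:
  assumes f: "f \<in> analytic" and orth: "\<And>x. cinner f (J x) = 0" "\<And>x. cinner f (W (J x)) = 0"
  shows "Wi f \<in> analytic"
proof -
  define y where "y j i = cinner f ((Zi ^^ j) (W (J (v i))))" for j i
  have zero: "cinner f ((Zi ^^ j) (J x)) = 0" for j x
    using analyticD[OF f, of j] orth(1) by (cases j) auto
  \<comment> \<open>The exponent \<open>Suc j\<close> leaves \<open>Zi ^^ j\<close> after one factor
    cancels against the \<open>Z\<close> in \<open>moebius\<close>.\<close>
  have rec: "y (Suc j) i + a i * y j i
      = cnj (l i) * (cinner f ((Zi ^^ j) (J (u i))) + cnj (a i) * cinner f ((Zi ^^ Suc j) (J (u i))))" for j i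
    using arg_cong[OF moebius[of i], of "\<lambda>x. cinner f ((Zi ^^ Suc j) x)"]
    by (simp add: y_def Zi_pow_add Zi_pow_scale cinner_add_right cinner_scaleC_right funpow_swap1
        inverse add scale)
  have y0: "y j i = 0" for j i
  proof (induction j)
    case 0
    then show ?case
      using orth(2) by (simp add: y_def)
  next
    case (Suc j)
    then show ?case
      using rec[of j i] zero[of j] zero[of "Suc j"] by simp
  qed
  have pow: "(Zi ^^ j) (W x) = W ((Zi ^^ j) x)" for j x
    by (induction j) (auto simp: commute')
  have cWi: "cinner (Wi f) ((Zi ^^ j) (J (v i))) = y j i" for j i
    by (simp add: adjoint' y_def pow)
  show ?thesis
    unfolding analytic_def by (intro CollectI allI impI, rule cinner_J_v_zero) (simp only: cWi y0)
qed

text \<open>Orthogonality to the whole orbit passes from \<open>g\<close> to \<open>Wi g\<close>,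
  since moving \<open>Wi\<close> across raises the exponent \<open>m\<close> by one. So
  \<open>Wi_analytic\<close> can be iterated, and \<open>f\<close> is residual.\<close>

lemma analytic_orthogonal_zero:
  assumes "f \<in> analytic" and "\<And>m x. cinner f ((W ^^ m) (J x)) = 0"
  shows "f = 0"
proof -
  have "(Wi ^^ k) f \<in> analytic \<and> (\<forall>m x. cinner ((Wi ^^ k) f) ((W ^^ m) (J x)) = 0)" for k
  proof (induction k)
    case (Suc k)
    then have "cinner ((Wi ^^ k) f) ((W ^^ 0) (J x)) = 0" "cinner ((Wi ^^ k) f) ((W ^^ 1) (J x)) = 0" for x
      by blast+
    moreover have "cinner ((Wi ^^ Suc k) f) ((W ^^ m) (J x)) = 0" for m x
      using Suc.IH[THEN conjunct2, rule_format, of "Suc m" x] by (simp add: adjoint')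
    ultimately show ?case
      using Suc.IH Wi_analytic[of "(Wi ^^ k) f"] by simp
  qed (use assms in simp)
  then show ?thesis
    by (intro residual_zero) (auto simp: residual_def)
qed

lemma orbit_analytic: "(W ^^ m) (J x) \<in> analytic"
  using coeff0_W_pow[OF J_analytic] by blast

text \<open>The orbit stays in the closed subspace \<open>analytic\<close>; conversely
  \<open>f\<close> minus its projection onto the closed span is analytic and orthogonal to the
  orbit, hence zero.\<close>

theorem analytic_eq_closure_span:
  "analytic = closure (cmod.span {(W ^^ m) (J x) | m x. True})"
    (is "_ = closure (cmod.span ?S)")
proof
  show "closure (cmod.span ?S) \<subseteq> analytic"
    by (intro closure_minimal closed_analytic cmod.span_minimal subspace_analytic)
      (auto simp: orbit_analytic)
  show "analytic \<subseteq> closure (cmod.span ?S)"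
  proof
    fix f assume f: "f \<in> analytic"
    have sub: "cmod.subspace (closure (cmod.span ?S))"
      by (intro subspace_closure cmod.subspace_span)
    have "complete (closure (cmod.span ?S))"
      using complete complete_closed_subset[of _ UNIV] by blast
    then obtain p where p: "p \<in> closure (cmod.span ?S)"
        "\<And>m. m \<in> closure (cmod.span ?S) \<Longrightarrow> cinner (f - p) m = 0"
      using ex_orthogonal_projection[OF _ sub] by blast
    have "f - p = 0"
    proof (rule analytic_orthogonal_zero)
      show "f - p \<in> analytic"
        using f p(1) \<open>closure (cmod.span ?S) \<subseteq> analytic\<close> by (auto intro: cmod.subspace_diff[OF subspace_analytic])
      show "cinner (f - p) ((W ^^ m) (J x)) = 0" for m x
        by (intro p subsetD[OF closure_subset] cmod.span_base) auto
    qed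
    then show "f \<in> closure (cmod.span ?S)"
      using p(1) by simp
  qed
qed

text \<open>Since \<open>coeff0\<close> is adjoint to \<open>J\<close> and \<open>J\<close> is
  isometric, projecting onto \<open>range J\<close> amounts to taking the zeroth coefficient, on
  which \<open>W\<close> acts as \<open>T\<close>.\<close>

lemma compression:
  "J ((T ^^ k) x) = orth_proj (range J) ((W ^^ k) (J x))"
proof (rule orth_proj_eqI[symmetric])
  show "cmod.subspace (range J)"
    using J_add[symmetric] J_scaleC[symmetric] norm_J[of 0]
    by (intro cmod.subspaceI) (auto simp: image_iff intro: exI[of _ 0])
  fix h assume "h \<in> range J"
  then obtain y where y: "h = J y"
    by auto
  have "cinner ((W ^^ k) (J x)) (J y) = cinner (coeff0 ((W ^^ k) (J x))) y"
    by (simp add: cinner_coeff0)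
  also have "\<dots> = cinner (J ((T ^^ k) x)) (J y)"
    using coeff0_W_pow[OF J_analytic, of k x] by (simp add: coeff0_J cinner_J)
  finally show "cinner ((W ^^ k) (J x) - J ((T ^^ k) x)) h = 0"
    by (simp add: y cinner_diff_left)
qed auto

end

section \<open>Orthogonal series\<close>

text \<open>By Pythagoras the squared norm of a block of the series is the same block of the series
  of squared norms.\<close>

lemma orthogonal_series:
  fixes e :: "nat \<Rightarrow> 'a::real_inner"
  assumes "complete (UNIV :: 'a set)" and orth: "\<And>i j. i \<noteq> j \<Longrightarrow> orthogonal (e i) (e j)"
    and sq: "summable (\<lambda>n. (norm (e n))\<^sup>2)"
  shows "summable e" and "(norm (suminf e))\<^sup>2 = (\<Sum>n. (norm (e n))\<^sup>2)"
proof -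
  have pyth: "(norm (sum e A))\<^sup>2 = (\<Sum>n\<in>A. (norm (e n))\<^sup>2)" if "finite A" for A
    using that by (intro norm_sum_Pythagorean) (auto simp: pairwise_def orth)
  have "Cauchy (\<lambda>n. sum e {..<n})"
  proof (rule metric_CauchyI)
    fix d :: real assume d: "d > 0"
    then obtain N where N: "\<And>m n. m \<ge> N \<Longrightarrow> norm (\<Sum>i=m..<n. (norm (e i))\<^sup>2) < d\<^sup>2"
      using sq[unfolded summable_Cauchy, rule_format, of "d\<^sup>2"] by auto
    have less: "dist (sum e {..<m}) (sum e {..<n}) < d" if "N \<le> m" "m \<le> n" for m n
    proof -
      have "sum e {..<n} - sum e {..<m} = sum e {m..<n}"
        using that by (simp add: sum_diff_nat_ivl atLeast0LessThan[symmetric])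
      then have "(dist (sum e {..<m}) (sum e {..<n}))\<^sup>2 = (\<Sum>i=m..<n. (norm (e i))\<^sup>2)"
        by (simp add: dist_norm norm_minus_commute[of "sum e {..<m}"] pyth)
      also have "\<dots> < d\<^sup>2"
        using N[OF that(1), of n] by simp
      finally show ?thesis
        using d by (simp add: power_less_imp_less_base)
    qed
    have "dist (sum e {..<m}) (sum e {..<n}) < d" if "N \<le> m" "N \<le> n" for m n
      using less[of m n] less[of n m] that by (cases "m \<le> n") (auto simp: dist_commute)
    then show "\<exists>N. \<forall>m\<ge>N. \<forall>n\<ge>N. dist (sum e {..<m}) (sum e {..<n}) < d"
      by blast
  qed
  then obtain s where "(\<lambda>n. sum e {..<n}) \<longlonglongrightarrow> s"
    using assms(1) unfolding complete_def by blast
  then show summable: "summable e"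
    by (auto simp: summable_def sums_def)
  have "(\<lambda>n. (norm (sum e {..<n}))\<^sup>2) \<longlonglongrightarrow> (norm (suminf e))\<^sup>2"
    using summable_LIMSEQ[OF summable] by (intro tendsto_intros)
  moreover have "(\<lambda>n. (norm (sum e {..<n}))\<^sup>2) \<longlonglongrightarrow> (\<Sum>n. (norm (e n))\<^sup>2)"
    using summable_LIMSEQ[OF sq] by (simp add: pyth)
  ultimately show "(norm (suminf e))\<^sup>2 = (\<Sum>n. (norm (e n))\<^sup>2)"
    by (rule LIMSEQ_unique)
qed

text \<open>Abel means of an orthogonal series; they will be the dilates of a Hardy function.
  Multipliers in the unit interval are controlled by Pythagoras: \<open>r ^ n\<close> gives
  summability and the norm bound, \<open>1 - r ^ n\<close> gives the distance to the limit.\<close>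

lemma orthogonal_series_Abel:
  fixes e :: "nat \<Rightarrow> 'a::real_inner"
  assumes comp: "complete (UNIV :: 'a set)" and orth: "\<And>i j. i \<noteq> j \<Longrightarrow> orthogonal (e i) (e j)"
    and sq: "summable (\<lambda>n. (norm (e n))\<^sup>2)"
  shows "((\<lambda>r::real. \<Sum>n. r ^ n *\<^sub>R e n) \<longlongrightarrow> suminf e) (at_left 1)"
    and "0 \<le> r \<Longrightarrow> r < 1 \<Longrightarrow> summable (\<lambda>n. r ^ n *\<^sub>R e n)"
    and "0 \<le> r \<Longrightarrow> r < 1 \<Longrightarrow> norm (\<Sum>n. r ^ n *\<^sub>R e n) \<le> norm (suminf e)"
proof -
  have scaled: "summable (\<lambda>n. (norm (m n *\<^sub>R e n))\<^sup>2)" "summable (\<lambda>n. m n *\<^sub>R e n)"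
    "(norm (\<Sum>n. m n *\<^sub>R e n))\<^sup>2 = (\<Sum>n. (m n)\<^sup>2 * (norm (e n))\<^sup>2)"
    if m: "\<And>n. 0 \<le> m n" "\<And>n. m n \<le> 1" for m :: "nat \<Rightarrow> real"
  proof -
    have le: "(norm (m n *\<^sub>R e n))\<^sup>2 \<le> (norm (e n))\<^sup>2" for n
      using m[of n] by (simp add: power_mult_distrib mult_left_le_one_le power_le_one)
    show s: "summable (\<lambda>n. (norm (m n *\<^sub>R e n))\<^sup>2)"
      using le by (intro summable_comparison_test'[OF sq, of 0]) simp
    have orth': "orthogonal (m i *\<^sub>R e i) (m j *\<^sub>R e j)" if "i \<noteq> j" for i j
      using orth[OF that] by (simp add: orthogonal_def)
    show "summable (\<lambda>n. m n *\<^sub>R e n)"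
      by (rule orthogonal_series(1)[OF comp orth' s])
    show "(norm (\<Sum>n. m n *\<^sub>R e n))\<^sup>2 = (\<Sum>n. (m n)\<^sup>2 * (norm (e n))\<^sup>2)"
      using orthogonal_series(2)[OF comp orth' s] by (simp add: power_mult_distrib)
  qed
  have sum_e: "summable e"
    using orthogonal_series(1)[OF comp orth sq] .
  show summable: "summable (\<lambda>n. r ^ n *\<^sub>R e n)" if "0 \<le> r" "r < 1" for r
    using that by (intro scaled) (auto simp: power_le_one)
  show "norm (\<Sum>n. r ^ n *\<^sub>R e n) \<le> norm (suminf e)" if r: "0 \<le> r" "r < 1"
  proof -
    have "(norm (\<Sum>n. r ^ n *\<^sub>R e n))\<^sup>2 = (\<Sum>n. (r ^ n)\<^sup>2 * (norm (e n))\<^sup>2)"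
      using r by (intro scaled) (auto simp: power_le_one)
    also have "\<dots> \<le> (\<Sum>n. (norm (e n))\<^sup>2)"
    proof (rule suminf_le[OF _ _ sq])
      show "(r ^ n)\<^sup>2 * (norm (e n))\<^sup>2 \<le> (norm (e n))\<^sup>2" for n
        using r by (simp add: mult_left_le_one_le power_le_one)
      show "summable (\<lambda>n. (r ^ n)\<^sup>2 * (norm (e n))\<^sup>2)"
        using scaled(1)[of "\<lambda>n. r ^ n"] r by (simp add: power_mult_distrib power_le_one)
    qed
    also have "\<dots> = (norm (suminf e))\<^sup>2"
      using orthogonal_series(2)[OF comp orth sq] by simp
    finally show ?thesis
      by (rule power2_le_imp_le) simp
  qed
  have ev: "\<forall>\<^sub>F r::real in at_left 1. 0 \<le> r \<and> r < 1"
    by (rule eventually_mono[OF eventually_at_left_real[of 0 "1::real"]]) auto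
  \<comment> \<open>Dominated convergence for series: each term tends to 0 as \<open>r\<close> tends
    to 1, and \<open>(norm (e n))\<^sup>2\<close> is a summable bound independent of
    \<open>r\<close>.\<close>
  have "((\<lambda>r::real. \<Sum>n. (1 - r ^ n)\<^sup>2 * (norm (e n))\<^sup>2) \<longlongrightarrow> (\<Sum>n. 0)) (at_left 1)"
  proof (rule tannerys_theorem[THEN conjunct2, THEN conjunct2])
    show "((\<lambda>r::real. (1 - r ^ n)\<^sup>2 * (norm (e n))\<^sup>2) \<longlongrightarrow> 0) (at_left 1)" for n
      by (rule tendsto_eq_intros refl | simp)+
    have "norm ((1 - r ^ n)\<^sup>2 * (norm (e n))\<^sup>2) \<le> (norm (e n))\<^sup>2" if "0 \<le> r \<and> r < 1" for n and r :: real
      using that by (simp add: abs_mult mult_left_le_one_le power_le_one)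
    then show "\<forall>\<^sub>F (n, r) in at_top \<times>\<^sub>F at_left 1. norm ((1 - r ^ n)\<^sup>2 * (norm (e n))\<^sup>2) \<le> (norm (e n))\<^sup>2"
      unfolding eventually_prod_filter
      by (intro exI[of _ "\<lambda>_. True"] exI[of _ "\<lambda>r. 0 \<le> r \<and> r < 1"] conjI ev) auto
  qed (use sq in auto)
  then have "((\<lambda>r::real. \<Sum>n. (1 - r ^ n)\<^sup>2 * (norm (e n))\<^sup>2) \<longlongrightarrow> 0) (at_left 1)"
    by simp
  then have "((\<lambda>r::real. (norm ((\<Sum>n. r ^ n *\<^sub>R e n) - suminf e))\<^sup>2) \<longlongrightarrow> 0) (at_left 1)"
  proof (rule Lim_transform_eventually)
    show "\<forall>\<^sub>F r in at_left 1. (\<Sum>n. (1 - r ^ n)\<^sup>2 * (norm (e n))\<^sup>2) = (norm ((\<Sum>n. r ^ n *\<^sub>R e n) - suminf e))\<^sup>2"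
      using ev
    proof eventually_elim
      case (elim r)
      then have "suminf e - (\<Sum>n. r ^ n *\<^sub>R e n) = (\<Sum>n. (1 - r ^ n) *\<^sub>R e n)"
        using suminf_diff[OF sum_e summable[of r]] by (simp add: algebra_simps)
      then show ?case
        using scaled(3)[of "\<lambda>n. 1 - r ^ n"] elim by (simp add: norm_minus_commute power_le_one)
    qed
  qed
  then have "((\<lambda>r::real. sqrt ((norm ((\<Sum>n. r ^ n *\<^sub>R e n) - suminf e))\<^sup>2)) \<longlongrightarrow> sqrt 0) (at_left 1)"
    by (intro tendsto_intros)
  then show "((\<lambda>r::real. \<Sum>n. r ^ n *\<^sub>R e n) \<longlongrightarrow> suminf e) (at_left 1)"
    by (simp add: tendsto_norm_zero_iff LIM_zero_iff)
qed

section \<open>Fourier expansion of analytic vectors\<close>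

context dilation_pair
begin

definition coeff :: "nat \<Rightarrow> 'k \<Rightarrow> complex ^ 'n"
  where "coeff n f = coeff0 ((Zi ^^ n) f)"

lemma Zi_Z_pow: "(Zi ^^ n) ((Z ^^ n) f) = f"
proof (induction n)
  case (Suc n)
  then show ?case
    by (simp add: funpow_swap1[of Zi] inverse)
qed simp

lemma cinner_Z_pow_J:
  "cinner ((Z ^^ m) (J x)) ((Z ^^ n) (J y)) = (if m = n then cinner x y else 0)"
proof -
  have lt: "cinner ((Z ^^ m) (J x)) ((Z ^^ n) (J y)) = 0" if nm: "n < m" for m n x y
  proof -
    obtain k where "m = n + k" "k > 0"
      using less_imp_add_positive[OF nm] by metis
    then show ?thesis
      by (simp add: cinner_Z_pow_shift funpow_add Zi_Z_pow wandering)
  qed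
  show ?thesis
  proof (cases m n rule: linorder_cases)
    case less
    then show ?thesis
      using lt[of m n y x] by (subst cinner_commute) simp
  next
    case equal
    then show ?thesis
      by (simp add: cinner_Z_pow_shift Zi_Z_pow cinner_J)
  next
    case greater
    then show ?thesis
      using lt[of n m x y] by simp
  qed
qed

lemma cinner_coeff: "cinner (coeff n f) x = cinner f ((Z ^^ n) (J x))"
  by (simp add: coeff_def cinner_coeff0 cinner_Z_pow_shift)

lemma norm_Z_pow_J: "norm ((Z ^^ n) (J x)) = norm x"
  by (induction n) (auto simp: norm_iso norm_J)

text \<open>Bessel's inequality makes the orthogonal series converge. Its sum has the same
  coefficients as \<open>f\<close> at all nonnegative indices, and both are analytic, so
  \<open>total\<close> identifies them.\<close>

lemma analytic_expansion:
  assumes f: "f \<in> analytic"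
  defines "e \<equiv> \<lambda>n. (Z ^^ n) (J (coeff n f))"
  shows "i \<noteq> j \<Longrightarrow> orthogonal (e i) (e j)" and "summable (\<lambda>n. (norm (e n))\<^sup>2)" and "suminf e = f"
proof -
  show orth: "orthogonal (e i) (e j)" if "i \<noteq> j" for i j
    using that by (simp add: e_def orthogonal_def inner_eq_Re_cinner cinner_Z_pow_J)
  have "(\<Sum>n<N. (norm (e n))\<^sup>2) \<le> (norm f)\<^sup>2" for N
  proof -
    have pyth: "(norm (sum e {..<N}))\<^sup>2 = (\<Sum>n<N. (norm (e n))\<^sup>2)"
      by (intro norm_sum_Pythagorean) (auto simp: pairwise_def orth)
    have "inner f (sum e {..<N}) = (\<Sum>n<N. (norm (e n))\<^sup>2)"
      unfolding inner_sum_right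
      by (intro sum.cong refl)
        (simp add: e_def inner_eq_Re_cinner cinner_coeff[symmetric] cinner_self norm_Z_pow_J)
    moreover have "0 \<le> (norm (f - sum e {..<N}))\<^sup>2"
      by simp
    ultimately show ?thesis
      using pyth by (simp add: power2_norm_eq_inner inner_diff_left inner_diff_right inner_commute)
  qed
  then show sq: "summable (\<lambda>n. (norm (e n))\<^sup>2)"
    by (intro bounded_imp_summable[where B = "(norm f)\<^sup>2"]) (simp_all only: lessThan_Suc_atMost[symmetric] zero_le_power2)
  have summable: "summable e"
    by (rule orthogonal_series(1)[OF complete orth sq])
  have e_analytic: "e n \<in> analytic" for n
    by (simp add: e_def Z_pow_J_analytic)
  have "(\<lambda>n. sum e {..<n}) \<longlonglongrightarrow> suminf e"
    by (rule summable_LIMSEQ[OF summable])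
  then have "suminf e \<in> analytic"
    by (rule closed_sequentially[OF closed_analytic, rotated])
      (auto intro!: cmod.subspace_sum[OF subspace_analytic] e_analytic)
  then have diff: "f - suminf e \<in> analytic"
    using f by (intro cmod.subspace_diff subspace_analytic)
  have orth_Z: "cinner (f - suminf e) ((Z ^^ n) (J x)) = 0" for n x
  proof -
    have "cinner (suminf e) ((Z ^^ n) (J x)) = (\<Sum>k. cinner (e k) ((Z ^^ n) (J x)))"
      by (rule bounded_linear.suminf[OF bounded_linear_cinner_left summable])
    also have "\<dots> = cinner (e n) ((Z ^^ n) (J x))"
      by (subst suminf_finite[of "{n}"]) (auto simp: e_def cinner_Z_pow_J)
    also have "\<dots> = cinner f ((Z ^^ n) (J x))"
      by (simp add: e_def cinner_Z_pow_J cinner_coeff)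
    finally show ?thesis
      by (simp add: cinner_diff_left)
  qed
  have "f - suminf e = 0"
  proof (rule total)
    show "cinner (f - suminf e) ((Zi ^^ n) (J x)) = 0" for n x
      using analyticD[OF diff, of n] orth_Z[of 0] by (cases n) auto
  qed (rule orth_Z)
  then show "suminf e = f"
    by simp
qed

end

section \<open>Multiplication operators\<close>

lemma square_integrable_rep: "square_integrable (rep_L2 f)"
  using Quotient3_rep_reflp[OF Quotient3_L2, of f] by blast

lemma abs_rep_L2 [simp]: "abs_L2 (rep_L2 f) = f"
  by (rule Quotient3_abs_rep[OF Quotient3_L2])

lemma abs_L2_eq_iff:
  "square_integrable f \<Longrightarrow> square_integrable g \<Longrightarrow>
    abs_L2 f = abs_L2 g \<longleftrightarrow> (AE z in circle_measure. f z = g z)"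
  using Quotient3_rel[OF Quotient3_L2, of f g] by auto

lemma rep_abs_L2: "square_integrable f \<Longrightarrow> AE z in circle_measure. rep_L2 (abs_L2 f) z = f z"
  using abs_L2_eq_iff[OF square_integrable_rep, of f "abs_L2 f"] by simp

lemma L2_cases:
  obtains f where "square_integrable f" "x = abs_L2 f"
  using square_integrable_rep[of x] abs_rep_L2[of x] by metis

lemma abs_L2_scaleC:
  "square_integrable f \<Longrightarrow> scaleC c (abs_L2 f) = abs_L2 (\<lambda>z. scaleC c (f z))"
  by (simp add: scaleC_L2.abs_eq)

lemma
  assumes "square_integrable f" "square_integrable g"
  shows abs_L2_add: "abs_L2 f + abs_L2 g = abs_L2 (\<lambda>z. f z + g z)"
    and abs_L2_diff: "abs_L2 f - abs_L2 g = abs_L2 (\<lambda>z. f z - g z)"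
    and cinner_abs_L2: "cinner (abs_L2 f) (abs_L2 g) = (\<integral>z. cinner (f z) (g z) \<partial>circle_measure)"
  using assms by (simp_all add: plus_L2.abs_eq minus_L2.abs_eq cinner_L2.abs_eq)

lemma norm_abs_L2:
  assumes f: "square_integrable f"
  shows "(norm (abs_L2 f))\<^sup>2 = (\<integral>z. (norm (f z))\<^sup>2 \<partial>circle_measure)"
proof -
  have "(norm (abs_L2 f))\<^sup>2 = Re (\<integral>z. cinner (f z) (f z) \<partial>circle_measure)"
    using cinner_self[of "abs_L2 f"] f by (simp add: cinner_abs_L2)
  also have "\<dots> = (\<integral>z. (norm (f z))\<^sup>2 \<partial>circle_measure)"
    by (subst integral_Re[symmetric])
      (auto simp: integrable_cinner f power2_norm_eq_inner inner_eq_Re_cinner)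
  finally show ?thesis .
qed

lemma space_circle_measure: "space circle_measure = sphere 0 1"
  by (simp add: circle_measure_def space_restrict_space)

lemma sets_circle_measure: "sets circle_measure = sets (restrict_space borel (sphere 0 1))"
  by (simp add: circle_measure_def)

interpretation circle: finite_measure circle_measure
  by (rule finite_measure_circle)

lemma measure_circle_space [simp]: "measure circle_measure (space circle_measure) = 1"
  by (simp add: measure_def emeasure_circle_space)

lemma borel_measurable_circle:
  fixes f :: "complex \<Rightarrow> 'a::topological_space"
  assumes "continuous_on (sphere 0 1) f"
  shows "f \<in> borel_measurable circle_measure"
proof -
  have "f \<in> borel_measurable (restrict_space borel (sphere 0 1))"
    by (rule borel_measurable_continuous_on_restrict[OF assms])
  then show ?thesis
    using measurable_cong_sets[OF sets_circle_measure refl] by blast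
qed

lemma bounded_on_circle:
  fixes f :: "complex \<Rightarrow> 'a::real_normed_vector"
  assumes "continuous_on (sphere 0 1) f"
  shows "\<exists>B>0. \<forall>z\<in>sphere 0 1. norm (f z) \<le> B"
  using compact_imp_bounded[OF compact_continuous_image[OF assms compact_sphere]]
  unfolding bounded_pos by (metis image_eqI)

lemma square_integrable_continuous:
  assumes f: "continuous_on (sphere 0 1) f"
  shows "square_integrable f"
proof -
  obtain B where B: "\<And>z. z \<in> sphere 0 1 \<Longrightarrow> norm (f z) \<le> B" "B > 0"
    using bounded_on_circle[OF f] by blast
  note [measurable] = borel_measurable_circle[OF f]
  have "integrable circle_measure (\<lambda>z. (norm (f z))\<^sup>2)"
    using B by (intro circle.integrable_const_bound[where B = "B\<^sup>2"] AE_I2)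
      (auto simp: space_circle_measure intro!: power_mono)
  then show ?thesis
    by (simp add: square_integrable_def)
qed

lemma norm_abs_L2_le:
  assumes f: "square_integrable f" and B: "\<And>z. z \<in> sphere 0 1 \<Longrightarrow> norm (f z) \<le> B" "0 \<le> B"
  shows "norm (abs_L2 f) \<le> B"
proof -
  have "(\<integral>z. (norm (f z))\<^sup>2 \<partial>circle_measure) \<le> (\<integral>z. B\<^sup>2 \<partial>circle_measure)"
    using f B by (intro integral_mono) (auto simp: square_integrable_def space_circle_measure intro!: power_mono)
  then have "(norm (abs_L2 f))\<^sup>2 \<le> B\<^sup>2"
    by (simp add: norm_abs_L2[OF f])
  then show ?thesis
    using B(2) by (rule power2_le_imp_le)
qed

text \<open>The sum of the moduli of the entries is a crude bound, but it is visibly continuous in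
  the matrix, so it is bounded along a continuous matrix function on the circle.\<close>

lemma norm_matrix_vector_mult_le:
  fixes A :: "complex ^ 'n ^ 'm"
  shows "norm (A *v x) \<le> (\<Sum>i\<in>UNIV. \<Sum>j\<in>UNIV. norm (A $ i $ j)) * norm x"
proof -
  have "norm (A *v x) \<le> (\<Sum>i\<in>UNIV. norm ((A *v x) $ i))"
    unfolding norm_vec_def by (rule L2_set_le_sum) simp
  also have "\<dots> \<le> (\<Sum>i\<in>UNIV. \<Sum>j\<in>UNIV. norm (A $ i $ j) * norm x)"
    unfolding matrix_vector_mult_def vec_lambda_beta
    by (intro sum_mono order_trans[OF norm_sum])
      (auto simp: norm_mult intro!: mult_left_mono Finite_Cartesian_Product.norm_nth_le)
  finally show ?thesis
    by (simp add: sum_distrib_right)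
qed

lemma square_integrable_mult:
  fixes A :: "complex \<Rightarrow> complex ^ 'n ^ 'n"
  assumes A: "continuous_on (sphere 0 1) A" and f: "square_integrable f"
  shows "square_integrable (\<lambda>z. A z *v f z)"
proof -
  have "continuous_on (sphere 0 1) (\<lambda>z. \<Sum>i\<in>UNIV. \<Sum>j\<in>UNIV. norm (A z $ i $ j))"
    by (intro continuous_intros A)
  from bounded_on_circle[OF this] obtain B where B:
      "\<And>z. z \<in> sphere 0 1 \<Longrightarrow> (\<Sum>i\<in>UNIV. \<Sum>j\<in>UNIV. norm (A z $ i $ j)) \<le> B" "B > 0"
    by (force simp: real_norm_def dest: abs_le_D1)
  have [measurable]: "A \<in> borel_measurable circle_measure" "f \<in> borel_measurable circle_measure"
    using borel_measurable_circle[OF A] f by (auto simp: square_integrable_def)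
  have "continuous_on UNIV (\<lambda>p :: (complex ^ 'n ^ 'n) \<times> (complex ^ 'n). fst p *v snd p)"
    unfolding matrix_vector_mult_def by (intro continuous_intros)
  then have [measurable]: "(\<lambda>z. A z *v f z) \<in> borel_measurable circle_measure"
    by (rule borel_measurable_continuous_Pair[rotated 2]) measurable
  have le: "(norm (A z *v f z))\<^sup>2 \<le> B\<^sup>2 * (norm (f z))\<^sup>2" if "z \<in> sphere 0 1" for z
  proof -
    have "norm (A z *v f z) \<le> B * norm (f z)"
      by (rule order_trans[OF norm_matrix_vector_mult_le mult_right_mono[OF B(1)[OF that]]]) simp
    then show ?thesis
      unfolding power_mult_distrib[symmetric] by (rule power_mono) simp
  qed
  have "integrable circle_measure (\<lambda>z. (norm (A z *v f z))\<^sup>2)"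
  proof (rule Bochner_Integration.integrable_bound)
    show "integrable circle_measure (\<lambda>z. B\<^sup>2 * (norm (f z))\<^sup>2)"
      using f by (simp add: square_integrable_def)
    show "AE z in circle_measure. norm ((norm (A z *v f z))\<^sup>2) \<le> norm (B\<^sup>2 * (norm (f z))\<^sup>2)"
      using le by (intro AE_I2) (simp only: space_circle_measure real_norm_def abs_mult abs_power2)
  qed measurable
  then show ?thesis
    by (simp add: square_integrable_def)
qed

section \<open>Calculus of multiplication by continuous matrix functions\<close>

text \<open>Frees \<open>mult_op\<close> from the representative chosen in its definition: equality
  almost everywhere survives multiplication by \<open>A z\<close>.\<close>

lemma mult_op_abs:
  assumes A: "continuous_on (sphere 0 1) A" and f: "square_integrable f"
  shows "mult_op A (abs_L2 f) = abs_L2 (\<lambda>z. A z *v f z)"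
  unfolding mult_op_def
  using rep_abs_L2[OF f]
  by (subst abs_L2_eq_iff) (auto intro!: square_integrable_mult A f square_integrable_rep elim!: eventually_mono)

lemma mult_op_cong:
  assumes A: "continuous_on (sphere 0 1) A" and "\<And>z. z \<in> sphere 0 1 \<Longrightarrow> A z = B z"
  shows "mult_op A = mult_op B"
proof
  fix x
  have B: "continuous_on (sphere 0 1) B"
    using A assms(2) continuous_on_cong by metis
  show "mult_op A x = mult_op B x"
    by (cases x rule: L2_cases)
      (auto simp: mult_op_abs A B abs_L2_eq_iff square_integrable_mult space_circle_measure assms(2)
        intro!: AE_I2)
qed

lemma mult_op_compose:
  assumes A: "continuous_on (sphere 0 1) A" and B: "continuous_on (sphere 0 1) B"
  shows "mult_op A (mult_op B x) = mult_op (\<lambda>z. A z ** B z) x"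
proof -
  have AB: "continuous_on (sphere 0 1) (\<lambda>z. A z ** B z)"
    unfolding matrix_matrix_mult_def using A B by (intro continuous_intros)
  show ?thesis
    by (cases x rule: L2_cases)
      (auto simp: mult_op_abs A B AB square_integrable_mult matrix_vector_mul_assoc)
qed

lemma mult_op_id: "mult_op (\<lambda>_. mat 1) x = x"
  by (cases x rule: L2_cases) (simp add: mult_op_abs)

lemma matrix_vector_mult_scaleC: "A *v scaleC c x = scaleC c (A *v x)"
  for A :: "complex ^ 'n ^ 'm"
  by (simp add: vec_eq_iff matrix_vector_mult_def scaleC_vec_def scaleC_complex_def sum_distrib_left
      mult.left_commute)

lemma clinear_mult_op:
  assumes A: "continuous_on (sphere 0 1) A"
  shows "clinear_on UNIV (mult_op A)"
  unfolding clinear_on_def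
proof (intro conjI ballI allI)
  fix x y :: "'a L2" and c
  obtain f g where "square_integrable f" "x = abs_L2 f" "square_integrable g" "y = abs_L2 g"
    using L2_cases by metis
  then show "mult_op A (x + y) = mult_op A x + mult_op A y"
    "mult_op A (scaleC c x) = scaleC c (mult_op A x)"
    by (simp_all add: abs_L2_add abs_L2_scaleC mult_op_abs A square_integrable_mult
        square_integrable_add square_integrable_scaleC matrix_vector_right_distrib
        matrix_vector_mult_scaleC)
qed

lemma cinner_adjoint_matrix:
  fixes A :: "complex ^ 'n ^ 'm"
  shows "cinner (A *v x) y = cinner x (adjoint_matrix A *v y)"
proof -
  have "cinner (A *v x) y = (\<Sum>i\<in>UNIV. \<Sum>j\<in>UNIV. A $ i $ j * x $ j * cnj (y $ i))"
    by (simp add: cinner_vec_def cinner_complex_def matrix_vector_mult_def sum_distrib_right)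
  also have "\<dots> = (\<Sum>j\<in>UNIV. \<Sum>i\<in>UNIV. A $ i $ j * x $ j * cnj (y $ i))"
    by (rule sum.swap)
  also have "\<dots> = cinner x (adjoint_matrix A *v y)"
    by (simp add: cinner_vec_def cinner_complex_def matrix_vector_mult_def sum_distrib_left
        adjoint_matrix_def algebra_simps)
  finally show ?thesis .
qed

lemma continuous_on_adjoint_matrix:
  "continuous_on S A \<Longrightarrow> continuous_on S (\<lambda>z. adjoint_matrix (A z))"
  unfolding adjoint_matrix_def by (intro continuous_intros)

lemma cinner_mult_op:
  assumes A: "continuous_on (sphere 0 1) A"
  shows "cinner (mult_op A x) y = cinner x (mult_op (\<lambda>z. adjoint_matrix (A z)) y)"
proof -
  obtain f g where "square_integrable f" "x = abs_L2 f" "square_integrable g" "y = abs_L2 g"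
    using L2_cases by metis
  then show ?thesis
    by (simp add: mult_op_abs A continuous_on_adjoint_matrix square_integrable_mult cinner_abs_L2
        cinner_adjoint_matrix)
qed

section \<open>Totality of the trigonometric monomials\<close>

lemma cis_measurable_circle:
  "cis \<in> measurable (uniform_measure lborel {0..2 * pi}) (restrict_space borel (sphere 0 1))"
  by (intro measurable_restrict_space2)
    (auto simp: uniform_measure_def intro!: borel_measurable_continuous_onI continuous_intros)

text \<open>In the angle the integrand is \<open>exp (\<i> * n * x)\<close>, which for
  \<open>n > 0\<close> has an antiderivative of period \<open>2 * pi\<close>.\<close>

lemma integral_circle_power:
  assumes "n > 0"
  shows "(\<integral>z. z ^ n \<partial>circle_measure) = 0"
proof -
  define F where "F x = exp (\<i> * of_nat n * x) / (\<i> * of_nat n)" for x :: complex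
  have deriv: "((\<lambda>x. F (of_real x)) has_vector_derivative cis x ^ n) (at x within {0..2 * pi})" for x
  proof (rule has_vector_derivative_real_field)
    have "cis x ^ n = exp (\<i> * of_nat n * of_real x)"
      by (simp add: cis_conv_exp exp_of_nat_mult[symmetric] mult_ac)
    then show "(F has_field_derivative cis x ^ n) (at (of_real x))"
      unfolding F_def using assms by (auto intro!: derivative_eq_intros)
  qed
  have "F (of_real (2 * pi)) = F (of_real 0)"
    using exp_integer_2pi[of "of_nat n"] by (simp add: F_def mult_ac)
  moreover have "continuous_on {0..2 * pi} (\<lambda>x. cis x ^ n)"
    by (intro continuous_intros)
  ultimately have zero: "(\<integral>x. indicator {0..2 * pi} x *\<^sub>R cis x ^ n \<partial>lborel) = 0"
    using integral_FTC_Icc[of 0 "2 * pi" "\<lambda>x. F (of_real x)" "\<lambda>x. cis x ^ n"] deriv by simp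
  have unif: "uniform_measure lborel {0..2 * pi}
      = density lborel (\<lambda>x. ennreal (indicator {0..2 * pi} x / (2 * pi)))"
    unfolding uniform_measure_def
    by (intro arg_cong[of _ _ "density lborel"]) (use divide_ennreal[of 1 "2 * pi"] in \<open>auto simp: fun_eq_iff split: split_indicator\<close>)
  have "(\<integral>z. z ^ n \<partial>circle_measure) = (\<integral>x. cis x ^ n \<partial>uniform_measure lborel {0..2 * pi})"
    unfolding circle_measure_def
    by (intro integral_distr cis_measurable_circle borel_measurable_continuous_on_restrict continuous_intros)
  also have "\<dots> = (\<integral>x. (indicator {0..2 * pi} x / (2 * pi)) *\<^sub>R cis x ^ n \<partial>lborel)"
    unfolding unif
    by (intro integral_density) (auto intro!: borel_measurable_continuous_onI continuous_intros)
  also have "\<dots> = (1 / (2 * pi)) *\<^sub>R (\<integral>x. indicator {0..2 * pi} x *\<^sub>R cis x ^ n \<partial>lborel)"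
    by (subst integral_scaleR_right[symmetric]) simp
  finally show ?thesis
    by (simp add: zero)
qed

text \<open>On the circle \<open>cnj z\<close> is the inverse of \<open>z\<close>, so a real
  polynomial in the real and imaginary parts is a Laurent polynomial in \<open>z\<close>; a power of
  \<open>z\<close> clears the negative exponents.\<close>

lemma real_polynomial_on_circle:
  assumes "real_polynomial_function h"
  shows "\<exists>p N. \<forall>z\<in>sphere 0 1. z ^ N * of_real (h z) = poly p (z :: complex)"
  using assms
proof induction
  case (linear h)
  \<comment> \<open>The coefficients come from \<open>Re z = (z + cnj z) / 2\<close> and
    \<open>Im z = - (\<i> / 2) * (z - cnj z)\<close> after multiplying by \<open>z\<close> and using
    \<open>z * cnj z = 1\<close>.\<close>
  have "z * of_real (h z) = poly [: (h 1 + \<i> * h \<i>) / 2, 0, (h 1 - \<i> * h \<i>) / 2 :] z"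
    if "z \<in> sphere 0 1" for z :: complex
  proof -
    have "z = Re z *\<^sub>R 1 + Im z *\<^sub>R \<i>"
      by (simp add: complex_eq_iff)
    then have "h z = h (Re z *\<^sub>R 1 + Im z *\<^sub>R \<i>)"
      by (rule arg_cong)
    also have "\<dots> = Re z * h 1 + Im z * h \<i>"
      using bounded_linear.linear[OF linear] by (simp only: linear_add linear_scale real_scaleR_def)
    finally have "h z = Re z * h 1 + Im z * h \<i>" .
    moreover have unit: "z * cnj z = 1"
      using that by (simp add: complex_norm_square[symmetric])
    have "of_real (Re z) = (z + cnj z) / 2"
      by (simp add: complex_eq_iff)
    then have "z * of_real (Re z) = (z * z + z * cnj z) / 2"
      by (simp only: times_divide_eq_right distrib_left)
    moreover have "of_real (Im z) = - (\<i> / 2) * (z - cnj z)"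
      by (simp add: complex_eq_iff)
    then have "z * of_real (Im z) = - (\<i> / 2) * (z * z - z * cnj z)"
      by (simp only: right_diff_distrib mult.left_commute[of z])
    ultimately have "z * of_real (h z) = (z * z + 1) / 2 * h 1 + - (\<i> / 2) * (z * z - 1) * h \<i>"
      unfolding unit by (simp add: distrib_left flip: mult.assoc)
    then show ?thesis
      by (simp add: field_simps power2_eq_square)
  qed
  then have "\<forall>z\<in>sphere 0 1. z ^ 1 * of_real (h z) = poly [: (h 1 + \<i> * h \<i>) / 2, 0, (h 1 - \<i> * h \<i>) / 2 :] z"
    unfolding power_one_right by blast
  then show ?case
    by blast
next
  case (const c)
  show ?case
    by (rule exI[of _ "[:of_real c:]"], rule exI[of _ 0]) simp
next
  case (add h k)
  then obtain p N q M where "\<forall>z\<in>sphere 0 1. z ^ N * of_real (h z) = poly p z"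
      "\<forall>z\<in>sphere 0 1. z ^ M * of_real (k z) = poly q z"
    by blast
  then show ?case
    by (intro exI[of _ "monom 1 M * p + monom 1 N * q"] exI[of _ "N + M"])
      (auto simp: poly_monom power_add algebra_simps)
next
  case (mult h k)
  then obtain p N q M where pq: "\<forall>z\<in>sphere 0 1. z ^ N * of_real (h z) = poly p z"
      "\<forall>z\<in>sphere 0 1. z ^ M * of_real (k z) = poly q z"
    by blast
  have "z ^ (N + M) * of_real (h z * k z) = poly (p * q) z" if "z \<in> sphere 0 1" for z
  proof -
    have "z ^ (N + M) * of_real (h z * k z) = (z ^ N * of_real (h z)) * (z ^ M * of_real (k z))"
      by (simp add: power_add mult_ac)
    also have "\<dots> = poly (p * q) z"
      using pq that by (simp only: poly_mult)
    finally show ?thesis .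
  qed
  then show ?case
    by blast
qed

lemma integrable_mult_continuous_circle:
  fixes g \<phi> :: "complex \<Rightarrow> complex"
  assumes g: "integrable circle_measure g" and \<phi>: "continuous_on (sphere 0 1) \<phi>"
  shows "integrable circle_measure (\<lambda>z. g z * \<phi> z)"
proof -
  obtain B where B: "\<And>z. z \<in> sphere 0 1 \<Longrightarrow> norm (\<phi> z) \<le> B" "B > 0"
    using bounded_on_circle[OF \<phi>] by blast
  note [measurable] = borel_measurable_circle[OF \<phi>] borel_measurable_integrable[OF g]
  show ?thesis
  proof (rule Bochner_Integration.integrable_bound)
    show "integrable circle_measure (\<lambda>z. B * norm (g z))"
      using g by simp
    show "AE z in circle_measure. norm (g z * \<phi> z) \<le> norm (B * norm (g z))"
      using B by (intro AE_I2) (auto simp: space_circle_measure norm_mult mult.commute intro!: mult_mono)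
  qed measurable
qed

text \<open>The class of test objects against which \<open>g\<close> integrates to 0 is enlarged in
  stages: monomials, real polynomials, continuous functions by Stone-Weierstrass, closed sets, Borel
  sets. Uniqueness of densities then gives \<open>g = 0\<close> almost everywhere.\<close>

lemma circle_moments_zero:
  fixes g :: "complex \<Rightarrow> complex"
  assumes g: "integrable circle_measure g"
    and pos: "\<And>n. (\<integral>z. g z * z ^ n \<partial>circle_measure) = 0"
    and neg: "\<And>n. (\<integral>z. g z * cnj z ^ n \<partial>circle_measure) = 0"
  shows "AE z in circle_measure. g z = 0"
proof -
  have int: "integrable circle_measure (\<lambda>z. g z * \<phi> z)" if "continuous_on (sphere 0 1) \<phi>" for \<phi>
    by (rule integrable_mult_continuous_circle[OF g that])
  have polynomial: "(\<integral>z. g z * of_real (h z) \<partial>circle_measure) = 0" if h: "real_polynomial_function h" for h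
  proof -
    obtain p N where p: "\<And>z. z \<in> sphere 0 1 \<Longrightarrow> z ^ N * of_real (h z) = poly p z"
      using real_polynomial_on_circle[OF h] by blast
    have unit: "z ^ k * cnj z ^ k = 1" if "z \<in> sphere 0 1" for z :: complex and k
      using that by (simp add: power_mult_distrib[symmetric] complex_norm_square[symmetric])
    \<comment> \<open>After cancelling \<open>z * cnj z = 1\<close>, each product is a pure power of
      \<open>cnj z\<close> or of \<open>z\<close>, according to which exponent is larger.\<close>
    have mono: "(\<integral>z. g z * (z ^ k * cnj z ^ N) \<partial>circle_measure) = 0" for k
    proof (cases "k \<le> N")
      case True
      then have "z ^ k * cnj z ^ N = cnj z ^ (N - k)" if "z \<in> sphere 0 1" for z :: complex
        using unit[OF that, of k] by (metis le_add_diff_inverse mult.assoc mult_1 power_add)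
      then have "(\<integral>z. g z * (z ^ k * cnj z ^ N) \<partial>circle_measure) = (\<integral>z. g z * cnj z ^ (N - k) \<partial>circle_measure)"
        by (intro Bochner_Integration.integral_cong) (auto simp: space_circle_measure)
      then show ?thesis
        by (simp add: neg)
    next
      case False
      then have "z ^ k * cnj z ^ N = z ^ (k - N)" if "z \<in> sphere 0 1" for z :: complex
        using unit[OF that, of N] power_add[of z "k - N" N] by simp
      then have "(\<integral>z. g z * (z ^ k * cnj z ^ N) \<partial>circle_measure) = (\<integral>z. g z * z ^ (k - N) \<partial>circle_measure)"
        by (intro Bochner_Integration.integral_cong) (auto simp: space_circle_measure)
      then show ?thesis
        by (simp add: pos)
    qed
    have "of_real (h z) = (\<Sum>k\<le>degree p. coeff p k * (z ^ k * cnj z ^ N))" if "z \<in> sphere 0 1" for z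
    proof -
      have "of_real (h z) = (z ^ N * cnj z ^ N) * of_real (h z)"
        by (simp only: unit[OF that] mult_1)
      also have "\<dots> = poly p z * cnj z ^ N"
        using p[OF that] by (simp add: mult_ac)
      finally show ?thesis
        by (simp add: poly_altdef sum_distrib_right mult.assoc)
    qed
    then have "(\<integral>z. g z * of_real (h z) \<partial>circle_measure)
        = (\<integral>z. (\<Sum>k\<le>degree p. coeff p k * (g z * (z ^ k * cnj z ^ N))) \<partial>circle_measure)"
      by (intro Bochner_Integration.integral_cong)
        (auto simp: space_circle_measure sum_distrib_left mult_ac)
    also have "\<dots> = (\<Sum>k\<le>degree p. coeff p k * (\<integral>z. g z * (z ^ k * cnj z ^ N) \<partial>circle_measure))"
      by (subst Bochner_Integration.integral_sum)
        (auto intro!: integrable_mult_right int continuous_intros)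
    finally show ?thesis
      by (simp add: mono)
  qed
  have cont: "(\<integral>z. g z * of_real (\<phi> z) \<partial>circle_measure) = 0" if \<phi>: "continuous_on (sphere 0 1) \<phi>" for \<phi>
  proof -
    define K where "K = (\<integral>z. norm (g z) \<partial>circle_measure)"
    have le: "norm (\<integral>z. g z * of_real (\<phi> z) \<partial>circle_measure) \<le> e * K" if "e > 0" for e
    proof -
      obtain h where h: "real_polynomial_function h" "\<And>z. z \<in> sphere 0 1 \<Longrightarrow> \<bar>\<phi> z - h z\<bar> < e"
        using Stone_Weierstrass_real_polynomial_function[OF compact_sphere \<phi> \<open>e > 0\<close>] by blast
      have h_cont: "continuous_on (sphere 0 1) h"
        using h(1) by (intro continuous_on_polymonial_function)
          (simp add: real_polynomial_function_eq)
      have "(\<integral>z. g z * of_real (\<phi> z) \<partial>circle_measure)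
          = (\<integral>z. g z * of_real (\<phi> z) - g z * of_real (h z) \<partial>circle_measure)"
        using polynomial[OF h(1)] by (subst Bochner_Integration.integral_diff) (auto intro!: int continuous_intros \<phi> h_cont)
      also have "norm \<dots> \<le> (\<integral>z. norm (g z * of_real (\<phi> z) - g z * of_real (h z)) \<partial>circle_measure)"
        by (rule integral_norm_bound)
      also have "\<dots> \<le> (\<integral>z. e * norm (g z) \<partial>circle_measure)"
      proof (rule integral_mono)
        show "integrable circle_measure (\<lambda>z. norm (g z * of_real (\<phi> z) - g z * of_real (h z)))"
          by (intro integrable_norm Bochner_Integration.integrable_diff int continuous_intros \<phi> h_cont)
        show "norm (g z * of_real (\<phi> z) - g z * of_real (h z)) \<le> e * norm (g z)"
          if "z \<in> space circle_measure" for z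
        proof -
          have "norm (g z * of_real (\<phi> z) - g z * of_real (h z)) = \<bar>\<phi> z - h z\<bar> * norm (g z)"
            by (simp add: right_diff_distrib[symmetric] norm_mult of_real_diff[symmetric] del: of_real_diff)
          then show ?thesis
            using h(2)[of z] that by (simp add: space_circle_measure mult_right_mono)
        qed
      qed (use g in simp)
      finally show ?thesis
        by (simp add: K_def)
    qed
    have "norm (\<integral>z. g z * of_real (\<phi> z) \<partial>circle_measure) \<le> 0 + d" if "d > 0" for d
    proof -
      have K: "K \<ge> 0"
        by (simp add: K_def)
      \<comment> \<open>Adding 1 to \<open>K\<close> keeps the quotient defined when
        \<open>K = 0\<close>.\<close>
      have "norm (\<integral>z. g z * of_real (\<phi> z) \<partial>circle_measure) \<le> d / (K + 1) * K"
        using that K by (intro le) auto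
      also have "\<dots> \<le> d"
        using that K by (simp add: field_simps)
      finally show ?thesis
        by simp
    qed
    then have "norm (\<integral>z. g z * of_real (\<phi> z) \<partial>circle_measure) \<le> 0"
      by (rule field_le_epsilon)
    then show ?thesis
      by simp
  qed
  have in_sets: "A \<inter> sphere 0 1 \<in> sets circle_measure" if "A \<in> sets borel" for A
    unfolding sets_circle_measure sets_restrict_space using that by (simp add: Int_commute)
  have closed_set: "(LINT z:C \<inter> sphere 0 1|circle_measure. g z) = 0" if C: "closed C" for C
  proof (cases "C = {}")
    case False
    \<comment> \<open>Continuous functions with values in the unit interval that tend pointwise to
      the indicator of \<open>C\<close>: off the closed set \<open>C\<close> the distance is
      positive, so they are eventually 0.\<close>
    define \<phi> where "\<phi> n z = max 0 (1 - real n * infdist z C)" for n z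
    have \<phi>: "continuous_on (sphere 0 1) (\<phi> n)" for n
      unfolding \<phi>_def by (intro continuous_intros)
    have lim: "(\<lambda>n. \<phi> n z) \<longlonglongrightarrow> indicator C z" for z
    proof (cases "z \<in> C")
      case True
      then show ?thesis
        by (simp add: \<phi>_def)
    next
      case z: False
      then have d: "infdist z C > 0"
        using in_closed_iff_infdist_zero[OF C False] infdist_nonneg[of z C] by (simp add: less_le)
      obtain N where "1 / infdist z C \<le> real N"
        using real_arch_simple by blast
      then have N: "1 \<le> real N * infdist z C"
        using d by (simp add: field_simps)
      have "\<phi> n z = 0" if "n \<ge> N" for n
      proof -
        have "real N * infdist z C \<le> real n * infdist z C"
          using d that by (intro mult_right_mono) auto
        then show ?thesis
          using N by (simp add: \<phi>_def)
      qed
      then show ?thesis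
        using z by (auto intro!: tendsto_eventually eventually_sequentiallyI)
    qed
    have "(\<lambda>n. \<integral>z. g z * of_real (\<phi> n z) \<partial>circle_measure)
        \<longlonglongrightarrow> (LINT z:C \<inter> sphere 0 1|circle_measure. g z)"
      unfolding set_lebesgue_integral_def
    proof (rule integral_dominated_convergence)
      show "integrable circle_measure (\<lambda>z. norm (g z))"
        using g by simp
      show "(\<lambda>z. g z * of_real (\<phi> n z)) \<in> borel_measurable circle_measure" for n
        by (intro borel_measurable_integrable int continuous_intros \<phi>)
      have "C \<inter> sphere 0 1 \<in> sets circle_measure"
        using C by (intro in_sets borel_closed)
      then show "(\<lambda>z. indicat_real (C \<inter> sphere 0 1) z *\<^sub>R g z) \<in> borel_measurable circle_measure"
        using borel_measurable_integrable[OF g] by simp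
      show "AE z in circle_measure. (\<lambda>n. g z * of_real (\<phi> n z)) \<longlonglongrightarrow> indicat_real (C \<inter> sphere 0 1) z *\<^sub>R g z"
      proof (rule AE_I2)
        fix z assume z: "z \<in> space circle_measure"
        have "(\<lambda>n. g z * of_real (\<phi> n z)) \<longlonglongrightarrow> g z * of_real (indicator C z)"
          by (intro tendsto_intros lim)
        moreover have "g z * of_real (indicator C z) = indicat_real (C \<inter> sphere 0 1) z *\<^sub>R g z"
          using z by (auto simp: space_circle_measure split: split_indicator)
        ultimately show "(\<lambda>n. g z * of_real (\<phi> n z)) \<longlonglongrightarrow> indicat_real (C \<inter> sphere 0 1) z *\<^sub>R g z"
          by simp
      qed
      have "\<bar>\<phi> n z\<bar> \<le> 1" for n z
        using mult_nonneg_nonneg[OF of_nat_0_le_iff infdist_nonneg] by (auto simp: \<phi>_def)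
      then show "AE z in circle_measure. norm (g z * of_real (\<phi> n z)) \<le> norm (g z)" for n
        by (intro AE_I2) (simp add: norm_mult mult_left_le)
    qed
    then show ?thesis
      by (simp add: cont[OF \<phi>] LIMSEQ_const_iff)
  qed (simp add: set_lebesgue_integral_def)
  have set_int: "set_integrable circle_measure A g" if "A \<in> sets circle_measure" for A
    using that g by (simp add: set_integrable_def integrable_mult_indicator)
  have borel: "(LINT z:A \<inter> sphere 0 1|circle_measure. g z) = 0" if "A \<in> sets borel" for A
  proof -
    have "sigma_sets UNIV (Collect closed) = sets (borel :: complex measure)"
      unfolding borel_eq_closed by simp
    note sets_eq = this
    have "Int_stable (Collect closed :: complex set set)"
      by (auto simp: Int_stable_def)
    moreover have "Collect closed \<subseteq> Pow (UNIV :: complex set)"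
      by simp
    moreover have "A \<in> sigma_sets UNIV (Collect closed)"
      using that by (simp add: sets_eq)
    ultimately show ?thesis
    \<comment> \<open>Closed sets form an intersection-stable generator, so Dynkin's argument
      applies; complements use that the integral over the whole circle is 0, the case of the closed
      set \<open>UNIV\<close>.\<close>
    proof (induction rule: sigma_sets_induct_disjoint)
      case (compl A)
      then have A: "A \<in> sets borel"
        by (simp add: sets_eq)
      have "(LINT z:sphere 0 1|circle_measure. g z)
          = (LINT z:(A \<inter> sphere 0 1) \<union> ((UNIV - A) \<inter> sphere 0 1)|circle_measure. g z)"
        by (rule arg_cong[of _ _ "\<lambda>S. LINT z:S|circle_measure. g z"]) auto
      also have "\<dots> = (LINT z:A \<inter> sphere 0 1|circle_measure. g z)
          + (LINT z:(UNIV - A) \<inter> sphere 0 1|circle_measure. g z)"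
        using A by (intro set_integral_Un set_int in_sets) auto
      finally show ?case
        using closed_set[of UNIV] compl by simp
    next
      case (union A)
      have A: "A i \<in> sets borel" for i
        using union(2) unfolding sets_eq by (rule subsetD) simp
      have "(LINT z:(\<Union>i. A i \<inter> sphere 0 1)|circle_measure. g z)
          = (\<Sum>i. LINT z:A i \<inter> sphere 0 1|circle_measure. g z)"
      proof (rule lebesgue_integral_countable_add)
        show A': "A i \<inter> sphere 0 1 \<in> sets circle_measure" for i
          by (intro in_sets A)
        show "(A i \<inter> sphere 0 1) \<inter> (A j \<inter> sphere 0 1) = {}" if "i \<noteq> j" for i j
          using disjoint_family_onD[OF union(1) UNIV_I UNIV_I that] by blast
        show "set_integrable circle_measure (\<Union>i. A i \<inter> sphere 0 1) g"
          by (intro set_int sets.countable_UN image_subsetI A')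
      qed
      moreover have "\<Union> (range A) \<inter> sphere 0 1 = (\<Union>i. A i \<inter> sphere 0 1)"
        by blast
      ultimately show ?case
        by (simp only: union(3) suminf_zero)
    qed (use closed_set closed_set[of "{}"] in simp_all)
  qed
  have zero: "(LINT z:A|circle_measure. g z) = 0" if A: "A \<in> sets circle_measure" for A
  proof -
    obtain A' where "A' \<in> sets borel" "A = A' \<inter> sphere 0 1"
      using A unfolding sets_circle_measure sets_restrict_space by blast
    then show ?thesis
      using borel by simp
  qed
  have "AE z in circle_measure. Re (g z) = 0"
  proof (rule density_unique_real)
    fix A assume A: "A \<in> sets circle_measure"
    have "(LINT z:A|circle_measure. Re (g z)) = Re (LINT z:A|circle_measure. g z)"
      using set_int[OF A] unfolding set_lebesgue_integral_def set_integrable_def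
      by (subst integral_Re[symmetric]) auto
    then show "(LINT z:A|circle_measure. Re (g z)) = (LINT z:A|circle_measure. 0)"
      using zero[OF A] by (simp add: set_lebesgue_integral_def)
  qed (use g in auto)
  moreover have "AE z in circle_measure. Im (g z) = 0"
  proof (rule density_unique_real)
    fix A assume A: "A \<in> sets circle_measure"
    have "(LINT z:A|circle_measure. Im (g z)) = Im (LINT z:A|circle_measure. g z)"
      using set_int[OF A] unfolding set_lebesgue_integral_def set_integrable_def
      by (subst integral_Im[symmetric]) auto
    then show "(LINT z:A|circle_measure. Im (g z)) = (LINT z:A|circle_measure. 0)"
      using zero[OF A] by (simp add: set_lebesgue_integral_def)
  qed (use g in auto)
  ultimately show ?thesis
    by eventually_elim (simp add: complex_eq_iff)
qed

section \<open>Completeness of \<open>L\<^sup>2\<close>\<close>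

lemma nn_integral_norm_square:
  assumes "square_integrable f"
  shows "(\<integral>\<^sup>+z. ennreal ((norm (f z))\<^sup>2) \<partial>circle_measure) = ennreal ((norm (abs_L2 f))\<^sup>2)"
  using assms by (subst nn_integral_eq_integral) (auto simp: norm_abs_L2 square_integrable_def)

text \<open>The form in which Fatou's lemma delivers square integrability of a limit.\<close>

lemma square_integrable_nn:
  assumes "f \<in> borel_measurable circle_measure"
    and "(\<integral>\<^sup>+z. ennreal ((norm (f z))\<^sup>2) \<partial>circle_measure) \<le> ennreal B"
  shows "square_integrable f"
  using assms le_less_trans[OF assms(2) ennreal_less_top]
  by (auto simp: square_integrable_def intro!: integrableI_bounded)

lemma nn_integral_norm_le:
  assumes f: "square_integrable f" and e: "norm (abs_L2 f) \<le> e" "e > 0"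
  shows "(\<integral>\<^sup>+z. ennreal (norm (f z)) \<partial>circle_measure) \<le> ennreal e"
proof -
  \<comment> \<open>AM-GM in place of the Cauchy-Schwarz inequality\<close>
  have le: "norm (f z) \<le> (norm (f z))\<^sup>2 / (2 * e) + e / 2" for z
    using sum_squares_bound[of "norm (f z)" e] e(2) by (simp add: field_simps power2_eq_square)
  have int: "integrable circle_measure (\<lambda>z. (norm (f z))\<^sup>2 / (2 * e) + e / 2)"
    using f by (simp add: square_integrable_def)
  have "(\<integral>\<^sup>+z. ennreal (norm (f z)) \<partial>circle_measure)
      \<le> (\<integral>\<^sup>+z. ennreal ((norm (f z))\<^sup>2 / (2 * e) + e / 2) \<partial>circle_measure)"
    by (intro nn_integral_mono ennreal_leI le)
  also have "\<dots> = ennreal (\<integral>z. (norm (f z))\<^sup>2 / (2 * e) + e / 2 \<partial>circle_measure)"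
    using int e(2) by (intro nn_integral_eq_integral AE_I2) auto
  also have "(\<integral>z. (norm (f z))\<^sup>2 / (2 * e) + e / 2 \<partial>circle_measure) = (norm (abs_L2 f))\<^sup>2 / (2 * e) + e / 2"
    using f by (subst Bochner_Integration.integral_add) (auto simp: square_integrable_def norm_abs_L2)
  also have "\<dots> \<le> e"
  proof -
    have "(norm (abs_L2 f))\<^sup>2 \<le> e\<^sup>2"
      using e by (intro power_mono) auto
    then show ?thesis
      using e(2) by (simp add: field_simps power2_eq_square)
  qed
  finally show ?thesis
    by (simp add: ennreal_leI)
qed

text \<open>The Riesz-Fischer argument: geometrically small increments are summable in the mean, so
  representatives converge almost everywhere, and Fatou's lemma turns this into convergence in
  norm.\<close>

lemma fast_Cauchy_L2_converges:
  fixes X :: "nat \<Rightarrow> 'n::finite L2"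
  assumes Cauchy: "Cauchy X" and fast: "\<And>n. norm (X (Suc n) - X n) \<le> (1 / 2) ^ n"
  shows "convergent X"
proof -
  define f where "f n = rep_L2 (X n)" for n
  have f: "square_integrable (f n)" "X n = abs_L2 (f n)" for n
    by (simp_all add: f_def square_integrable_rep)
  have [measurable]: "f n \<in> borel_measurable circle_measure" for n
    using f(1) by (auto simp: square_integrable_def)
  \<comment> \<open>Where the limit fails to exist the value of \<open>lim\<close> is arbitrary;
    this affects a null set only.\<close>
  define F where "F z = lim (\<lambda>n. f n z)" for z
  have F: "F \<in> borel_measurable circle_measure"
    unfolding F_def[abs_def] by measurable
  have "(\<integral>\<^sup>+z. (\<Sum>n. ennreal (norm (f (Suc n) z - f n z))) \<partial>circle_measure)
      = (\<Sum>n. \<integral>\<^sup>+z. ennreal (norm (f (Suc n) z - f n z)) \<partial>circle_measure)"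
    by (intro nn_integral_suminf) measurable
  also have "\<dots> \<le> (\<Sum>n. ennreal ((1 / 2) ^ n))"
  proof (intro suminf_le summableI nn_integral_norm_le square_integrable_diff f)
    show "norm (abs_L2 (\<lambda>z. f (Suc n) z - f n z)) \<le> (1 / 2) ^ n" for n
      using fast[of n] by (simp add: f(2) abs_L2_diff f(1))
  qed simp
  also have "\<dots> = ennreal (\<Sum>n. (1 / 2) ^ n)"
    by (intro suminf_ennreal2) (auto intro: summable_geometric)
  finally have "(\<integral>\<^sup>+z. (\<Sum>n. ennreal (norm (f (Suc n) z - f n z))) \<partial>circle_measure) \<noteq> \<infinity>"
    by (auto simp: top_unique)
  then have "AE z in circle_measure. (\<Sum>n. ennreal (norm (f (Suc n) z - f n z))) \<noteq> \<infinity>"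
    by (intro nn_integral_PInf_AE) measurable
  then have lim: "AE z in circle_measure. (\<lambda>n. f n z) \<longlonglongrightarrow> F z"
  proof eventually_elim
    fix z assume "(\<Sum>n. ennreal (norm (f (Suc n) z - f n z))) \<noteq> \<infinity>"
    then have "summable (\<lambda>n. norm (f (Suc n) z - f n z))"
      by (intro summable_suminf_not_top) auto
    then have "summable (\<lambda>n. f (Suc n) z - f n z)"
      by (rule summable_norm_cancel)
    then have "(\<lambda>n. f 0 z + (\<Sum>i<n. f (Suc i) z - f i z)) \<longlonglongrightarrow> f 0 z + (\<Sum>n. f (Suc n) z - f n z)"
      by (intro tendsto_add tendsto_const summable_LIMSEQ)
    then have "convergent (\<lambda>n. f n z)"
      using sum_lessThan_telescope[of "\<lambda>n. f n z"] by (auto simp: convergent_def)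
    then show "(\<lambda>n. f n z) \<longlonglongrightarrow> F z"
      unfolding F_def by (rule convergent_LIMSEQ_iff[THEN iffD1])
  qed
  \<comment> \<open>Fatou's lemma: \<open>F - f m\<close> is almost everywhere the limit of
    \<open>f n - f m\<close>, whose norms are at most \<open>e\<close> from \<open>n = m\<close>
    on.\<close>
  have bound: "(\<integral>\<^sup>+z. ennreal ((norm (F z - f m z))\<^sup>2) \<partial>circle_measure) \<le> ennreal (e\<^sup>2)"
    if m: "\<And>n. n \<ge> m \<Longrightarrow> norm (X n - X m) \<le> e" for m e
  proof -
    have "(\<integral>\<^sup>+z. ennreal ((norm (F z - f m z))\<^sup>2) \<partial>circle_measure)
        = (\<integral>\<^sup>+z. liminf (\<lambda>n. ennreal ((norm (f n z - f m z))\<^sup>2)) \<partial>circle_measure)"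
    proof (rule nn_integral_cong_AE, use lim in eventually_elim)
      fix z assume "(\<lambda>n. f n z) \<longlonglongrightarrow> F z"
      then have "(\<lambda>n. ennreal ((norm (f n z - f m z))\<^sup>2)) \<longlonglongrightarrow> ennreal ((norm (F z - f m z))\<^sup>2)"
        by (intro tendsto_intros)
      then show "ennreal ((norm (F z - f m z))\<^sup>2) = liminf (\<lambda>n. ennreal ((norm (f n z - f m z))\<^sup>2))"
        by (intro lim_imp_Liminf[symmetric]) simp_all
    qed
    also have "\<dots> \<le> liminf (\<lambda>n. \<integral>\<^sup>+z. ennreal ((norm (f n z - f m z))\<^sup>2) \<partial>circle_measure)"
      by (intro nn_integral_liminf) measurable
    also have "\<dots> \<le> ennreal (e\<^sup>2)"
    proof (rule Liminf_le)
      show "\<forall>\<^sub>F n in sequentially. (\<integral>\<^sup>+z. ennreal ((norm (f n z - f m z))\<^sup>2) \<partial>circle_measure) \<le> ennreal (e\<^sup>2)"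
        using eventually_ge_at_top[of m]
      proof eventually_elim
        case (elim n)
        have "(\<integral>\<^sup>+z. ennreal ((norm (f n z - f m z))\<^sup>2) \<partial>circle_measure) = ennreal ((norm (X n - X m))\<^sup>2)"
          by (simp add: nn_integral_norm_square square_integrable_diff f(1) f(2) abs_L2_diff)
        then show ?case
          using m[OF elim] by (simp add: ennreal_leI power_mono)
      qed
    qed simp
    finally show ?thesis .
  qed
  have Fm: "square_integrable (\<lambda>z. F z - f m z)" if "\<And>n. n \<ge> m \<Longrightarrow> norm (X n - X m) \<le> e" for m e
    by (rule square_integrable_nn[OF _ bound[OF that]]) (use F in measurable)
  have small: "\<exists>N. \<forall>m\<ge>N. \<forall>n\<ge>m. norm (X n - X m) \<le> e" if "e > 0" for e
    using CauchyD[OF Cauchy that] by (meson less_imp_le order_trans)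
  obtain m where m: "\<And>n. n \<ge> m \<Longrightarrow> norm (X n - X m) \<le> 1"
    using small[of 1] by auto
  have F_si: "square_integrable F"
    using square_integrable_add[OF Fm[OF m] f(1)[of m]] by simp
  have "X \<longlonglongrightarrow> abs_L2 F"
  proof (rule LIMSEQ_I)
    fix e :: real assume e: "e > 0"
    obtain N where N: "\<And>m n. m \<ge> N \<Longrightarrow> n \<ge> m \<Longrightarrow> norm (X n - X m) \<le> e / 2"
      using small[of "e / 2"] e by auto
    have "norm (X m - abs_L2 F) < e" if "m \<ge> N" for m
    proof -
      have "ennreal ((norm (abs_L2 F - X m))\<^sup>2) \<le> ennreal ((e / 2)\<^sup>2)"
        using bound[OF N[OF that]] nn_integral_norm_square[OF Fm[OF N[OF that]]]
        by (simp add: f(2) abs_L2_diff F_si f(1))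
      then have "(norm (abs_L2 F - X m))\<^sup>2 \<le> (e / 2)\<^sup>2"
        by (subst (asm) ennreal_le_iff) auto
      then have "norm (abs_L2 F - X m) \<le> e / 2"
        by (rule power2_le_imp_le) (use e in simp)
      then show ?thesis
        using e by (simp add: norm_minus_commute)
    qed
    then show "\<exists>N. \<forall>m\<ge>N. norm (X m - abs_L2 F) < e"
      by blast
  qed
  then show ?thesis
    by (auto simp: convergent_def)
qed

lemma complete_L2: "complete (UNIV :: 'n::finite L2 set)"
  unfolding complete_def
proof (intro allI impI)
  fix X :: "nat \<Rightarrow> 'n L2" assume "(\<forall>n. X n \<in> UNIV) \<and> Cauchy X"
  then have X: "Cauchy X"
    by simp
  have "\<exists>N. \<forall>m\<ge>N. \<forall>n\<ge>N. norm (X m - X n) < (1 / 2) ^ k" for k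
    by (rule CauchyD[OF X]) simp
  then obtain N where N: "\<And>k m n. m \<ge> N k \<Longrightarrow> n \<ge> N k \<Longrightarrow> norm (X m - X n) < (1 / 2) ^ k"
    by metis
  \<comment> \<open>The partial sums of \<open>N\<close> dominate each \<open>N k\<close>, and
    adding \<open>k\<close> makes the indices strictly increasing.\<close>
  define r where "r k = (\<Sum>i\<le>k. N i) + k" for k
  have r: "strict_mono r" "\<And>k. r k \<ge> N k"
    by (auto simp: r_def strict_mono_Suc_iff intro: trans_le_add1 member_le_sum)
  have "norm (X (r (Suc n)) - X (r n)) \<le> (1 / 2) ^ n" for n
    using N[of n "r (Suc n)" "r n"] r(2)[of n] strict_monoD[OF r(1), of n "Suc n"] by simp
  then have "convergent (X \<circ> r)"
    using Cauchy_subseq_Cauchy[OF X r(1)] by (intro fast_Cauchy_L2_converges) auto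
  then obtain l where "(X \<circ> r) \<longlonglongrightarrow> l"
    by (auto simp: convergent_def)
  then have "X \<longlonglongrightarrow> l"
    by (rule Cauchy_converges_subseq[OF X r(1)])
  then show "\<exists>l\<in>UNIV. X \<longlonglongrightarrow> l"
    by blast
qed

section \<open>The reversed pair and the two-sided orbit\<close>

context dilation_pair
begin

text \<open>The assumptions of the locale are symmetric under inverting \<open>Z\<close> and
  \<open>W\<close>, exchanging \<open>u\<close> with \<open>v\<close> and conjugating
  \<open>l\<close> and \<open>a\<close>. The relation left to check says that \<open>T'\<close> acts
  as the adjoint of \<open>T\<close>.\<close>

lemma reverse:
  assumes "\<And>x i. cinner (T' x) (v i) = cnj (l i) * cnj (a i) * cinner x (u i)"
    and "\<And>x. norm (T' x) \<le> q * norm x"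
  shows "dilation_pair J Zi Z Wi W T' q v u (\<lambda>i. cnj (l i)) (\<lambda>i. cnj (a i))"
proof
  fix x :: 'k and y and n :: nat
  show "Zi (Wi x) = Wi (Zi x)"
    by (rule commute')
  show "cinner ((Zi ^^ n) (J y)) (J z) = 0" if "n > 0" for z
    using wandering[OF that, of z y] cinner_commute[of _ "J z"]
    by (metis cinner_Z_pow_shift cinner_commute complex_cnj_zero)
  show "x = 0" if "\<And>n y. cinner x ((Zi ^^ n) (J y)) = 0" "\<And>n y. cinner x ((Z ^^ n) (J y)) = 0"
    using that by (rule total[rotated])
  show "Wi (J (u i)) + scaleC (cnj (cnj (a i))) (Zi (Wi (J (u i))))
      = scaleC (cnj (l i)) (Zi (J (v i)) + scaleC (cnj (a i)) (J (v i)))" for i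
    using moebius_inverse[of i] by simp
qed (use complete J linear inverse adjoint' a l u v q assms in auto)

lemma inv_W: "inv W = Wi"
  by (rule inv_equality) (auto simp: inverse)

text \<open>Nonnegative powers fill \<open>analytic\<close>, which contains all
  \<open>(Z ^^ n) (J x)\<close>; negative powers fill its counterpart for the reversed pair, which
  contains all \<open>(Zi ^^ n) (J x)\<close>. By \<open>total\<close> nothing is orthogonal to
  both.\<close>

lemma closure_span_int_iterate:
  assumes "dilation_pair J Zi Z Wi W T' q v u l' a'"
  shows "closure (cmod.span {int_iterate UNIV W m (J h) | m h. True}) = UNIV"
    (is "closure (cmod.span ?S) = _")
proof -
  interpret reverse: dilation_pair J Zi Z Wi W T' q v u l' a'
    by (rule assms)
  have "{(W ^^ m) (J h) | m h. True} \<subseteq> ?S"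
  proof clarify
    fix m h
    have "(W ^^ m) (J h) = int_iterate UNIV W (int m) (J h)"
      by (simp add: int_iterate_def)
    then show "\<exists>k g. (W ^^ m) (J h) = int_iterate UNIV W k (J g) \<and> True"
      by blast
  qed
  then have sub1: "analytic \<subseteq> closure (cmod.span ?S)"
    unfolding analytic_eq_closure_span by (intro closure_mono cmod.span_mono)
  have "{(Wi ^^ m) (J h) | m h. True} \<subseteq> ?S"
  proof clarify
    fix m h
    have "(Wi ^^ m) (J h) = int_iterate UNIV W (- int m) (J h)"
      \<comment> \<open>For \<open>m = 0\<close> the definition of \<open>int_iterate\<close> takes
        the branch of \<open>W\<close>, but both zeroth powers are the identity.\<close>
      by (cases "m = 0") (auto simp: int_iterate_def inv_W)
    then show "\<exists>k g. (Wi ^^ m) (J h) = int_iterate UNIV W k (J g) \<and> True"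
      by blast
  qed
  then have sub2: "reverse.analytic \<subseteq> closure (cmod.span ?S)"
    unfolding reverse.analytic_eq_closure_span by (intro closure_mono cmod.span_mono)
  have sub: "cmod.subspace (closure (cmod.span ?S))"
    by (intro subspace_closure cmod.subspace_span)
  have comp: "complete (closure (cmod.span ?S))"
    using complete complete_closed_subset[of _ UNIV] by blast
  have "f \<in> closure (cmod.span ?S)" for f
  proof -
    obtain p where p: "p \<in> closure (cmod.span ?S)"
        "\<And>m. m \<in> closure (cmod.span ?S) \<Longrightarrow> cinner (f - p) m = 0"
      using ex_orthogonal_projection[OF comp sub] by blast
    have "f - p = 0"
      by (rule total; intro p(2) subsetD[OF sub1] subsetD[OF sub2] Z_pow_J_analytic reverse.Z_pow_J_analytic)
    then show ?thesis
      using p(1) by simp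
  qed
  then show ?thesis
    by blast
qed

end

section \<open>Nelson dilations and the Hardy space\<close>

text \<open>Since \<open>mat z\<close> is \<open>z\<close> times the identity,
  \<open>mult_op mat\<close> is the shift and \<open>mult_op (\<lambda>z. mat (cnj z))\<close> its
  inverse.\<close>

lemma mat_vector_mult: "mat c *v x = scaleC c x" for x :: "complex ^ 'n"
proof (rule vec_eq_iff[THEN iffD2], rule allI)
  fix i
  have "(mat c *v x) $ i = (\<Sum>j\<in>UNIV. if i = j then c * x $ j else 0)"
    unfolding matrix_vector_mult_def mat_def vec_lambda_beta by (intro sum.cong) auto
  then show "(mat c *v x) $ i = scaleC c x $ i"
    by (simp add: scaleC_vec_def scaleC_complex_def)
qed

lemma const_L2_eq: "const_L2 x = abs_L2 (\<lambda>_. x)"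
  by (simp add: const_L2.abs_eq)

lemma continuous_on_mat: "continuous_on S \<phi> \<Longrightarrow> continuous_on S (\<lambda>z. mat (\<phi> z) :: complex ^ 'n ^ 'n)"
proof -
  assume \<phi>: "continuous_on S \<phi>"
  have "continuous_on S (\<lambda>z. if i = j then \<phi> z else 0)" for i j :: 'n
    using \<phi> by (cases "i = j") auto
  then show ?thesis
    unfolding mat_def by (intro continuous_on_vec_lambda)
qed

lemma shift_pow_const:
  assumes \<phi>: "continuous_on (sphere 0 1) \<phi>"
  shows "(mult_op (\<lambda>z. mat (\<phi> z)) ^^ n) (const_L2 x) = abs_L2 (\<lambda>z. scaleC (\<phi> z ^ n) x)"
proof (induction n)
  case (Suc n)
  have "continuous_on (sphere 0 1) (\<lambda>z. scaleC (\<phi> z ^ n) x)"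
    unfolding scaleC_vec_def scaleC_complex_def using \<phi> by (intro continuous_intros)
  with Suc show ?case
    by (simp add: mult_op_abs continuous_on_mat \<phi> square_integrable_continuous mat_vector_mult scaleC_scaleC)
qed (simp add: const_L2_eq scaleC_of_real[of 1, simplified])

lemma square_integrable_monomial:
  assumes "continuous_on (sphere 0 1) \<phi>"
  shows "square_integrable (\<lambda>z. scaleC (\<phi> z) x)"
  using assms unfolding scaleC_vec_def scaleC_complex_def
  by (intro square_integrable_continuous continuous_intros)

lemma adjoint_mat: "adjoint_matrix (mat c) = mat (cnj c)"
  by (auto simp: adjoint_matrix_def mat_def vec_eq_iff)

lemma mat_mult_commute: "mat c ** A = A ** mat c" for A :: "complex ^ 'n ^ 'n"
  by (simp add: matrix_eq matrix_vector_mul_assoc[symmetric] mat_vector_mult matrix_vector_mult_scaleC)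

lemma mat_mult_mat: "mat c ** mat d = (mat (c * d) :: complex ^ 'n ^ 'n)"
  by (simp add: matrix_eq matrix_vector_mul_assoc[symmetric] mat_vector_mult scaleC_scaleC)

lemma norm_const_L2: "norm (const_L2 x) = norm x"
proof -
  have "(norm (const_L2 x))\<^sup>2 = (norm x)\<^sup>2"
    by (simp add: const_L2_eq norm_abs_L2 square_integrable_const)
  then show ?thesis
    by (simp add: power2_eq_iff_nonneg)
qed

lemma isometry_const_L2: "isometry_on UNIV const_L2"
  by (auto simp: isometry_on_def clinear_on_def norm_const_L2)
    (auto simp: const_L2_eq abs_L2_add abs_L2_scaleC square_integrable_const)

lemma shift_wandering:
  assumes "n > 0"
  shows "cinner ((mult_op mat ^^ n) (const_L2 x)) (const_L2 y) = 0"
proof -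
  have "cinner ((mult_op mat ^^ n) (const_L2 x)) (const_L2 y) = (\<integral>z. z ^ n * cinner x y \<partial>circle_measure)"
    using shift_pow_const[OF continuous_on_id, of n x]
    by (simp add: const_L2_eq cinner_abs_L2 square_integrable_monomial square_integrable_const
        cinner_scaleC_left continuous_intros)
  then show ?thesis
    by (simp add: integral_circle_power[OF assms])
qed

lemma cinner_axis: "cinner x (axis i 1) = x $ i" for x :: "complex ^ 'n"
  by (simp add: cinner_vec_def cinner_complex_def axis_def if_distrib[of "\<lambda>c. _ * cnj c"] cong: if_cong)

text \<open>Each component of a representative has only zero moments, so
  \<open>circle_moments_zero\<close> applies componentwise.\<close>

lemma shift_total:
  fixes f :: "'n::finite L2"
  assumes pos: "\<And>n x. cinner f ((mult_op mat ^^ n) (const_L2 x)) = 0"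
    and neg: "\<And>n x. cinner f ((mult_op (\<lambda>z. mat (cnj z)) ^^ n) (const_L2 x)) = 0"
  shows "f = 0"
proof -
  obtain g where g: "square_integrable g" "f = abs_L2 g"
    using L2_cases by metis
  have "AE z in circle_measure. g z $ i = 0" for i
  proof (rule circle_moments_zero)
    show "integrable circle_measure (\<lambda>z. g z $ i)"
      using integrable_cinner[OF g(1) square_integrable_const, of "axis i 1"] by (simp add: cinner_axis)
    \<comment> \<open>The inner product conjugates its second argument, so the inverse shift yields
      the moments against \<open>z ^ n\<close>, and the shift those against
      \<open>cnj z ^ n\<close>.\<close>
    have *: "(\<integral>z. g z $ i * cnj (\<phi> z ^ n) \<partial>circle_measure)
        = cinner f ((mult_op (\<lambda>z. mat (\<phi> z)) ^^ n) (const_L2 (axis i 1)))"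
      if "continuous_on (sphere 0 1) \<phi>" for \<phi> n
      using that by (simp add: shift_pow_const g cinner_abs_L2 square_integrable_monomial
          cinner_scaleC_right cinner_axis mult.commute continuous_intros)
    show "(\<integral>z. g z $ i * z ^ n \<partial>circle_measure) = 0" for n
      using *[of cnj n] by (simp add: neg continuous_intros)
    show "(\<integral>z. g z $ i * cnj z ^ n \<partial>circle_measure) = 0" for n
      using *[of "\<lambda>z. z" n] pos[of n] by (simp add: continuous_intros)
  qed
  then have "AE z in circle_measure. \<forall>i\<in>UNIV. g z $ i = 0"
    by (intro AE_finite_allI) auto
  then have "abs_L2 g = abs_L2 (\<lambda>_. 0)"
    by (subst abs_L2_eq_iff) (auto simp: g square_integrable_const vec_eq_iff)
  then show ?thesis
    by (simp add: g(2) zero_L2.abs_eq)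
qed

section \<open>Unitary and diagonal matrices, disk automorphisms on the circle\<close>

lemma adjoint_adjoint_matrix [simp]: "adjoint_matrix (adjoint_matrix A) = A"
  by (simp add: adjoint_matrix_def vec_eq_iff)

lemma adjoint_matrix_mult: "adjoint_matrix (A ** B) = adjoint_matrix B ** adjoint_matrix A"
  by (simp add: adjoint_matrix_def matrix_matrix_mult_def vec_eq_iff mult.commute)

lemma adjoint_diag_matrix: "adjoint_matrix (diag_matrix d) = diag_matrix (\<lambda>i. cnj (d i))"
  by (auto simp: adjoint_matrix_def diag_matrix_def vec_eq_iff)

lemma diag_matrix_vector_mult: "(diag_matrix d *v x) $ i = d i * x $ i"
proof -
  have "(diag_matrix d *v x) $ i = (\<Sum>j\<in>UNIV. if i = j then d i * x $ j else 0)"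
    unfolding diag_matrix_def matrix_vector_mult_def vec_lambda_beta by (intro sum.cong) auto
  then show ?thesis
    by simp
qed

lemma diag_matrix_mult: "diag_matrix c ** diag_matrix d = diag_matrix (\<lambda>i. c i * d i)"
  by (simp add: matrix_eq matrix_vector_mul_assoc[symmetric] vec_eq_iff diag_matrix_vector_mult mult.assoc)

lemma diag_matrix_one: "diag_matrix (\<lambda>_. 1) = mat 1"
  by (simp add: diag_matrix_def mat_def)

lemma unitary_matrix_cancel:
  assumes "unitary_matrix U"
  shows "U *v (adjoint_matrix U *v x) = x" "adjoint_matrix U *v (U *v x) = x"
  using assms by (simp_all add: unitary_matrix_def matrix_vector_mul_assoc)

lemma cinner_unitary_axis: "cinner x (U *v axis i 1) = (adjoint_matrix U *v x) $ i"
  using cinner_adjoint_matrix[of "adjoint_matrix U" x "axis i 1"] by (simp add: cinner_axis)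

lemma unitary_expansion:
  assumes "unitary_matrix U"
  shows "(\<Sum>i\<in>UNIV. scaleC (cinner x (U *v axis i 1)) (U *v axis i 1)) = x"
proof -
  have "(\<Sum>i\<in>UNIV. scaleC (y $ i) (U *v axis i 1)) = U *v y" for y
    by (simp add: vec_eq_iff matrix_vector_mult_def scaleC_vec_def scaleC_complex_def axis_def
        if_distrib[of "\<lambda>c. _ * c"] mult.commute cong: if_cong)
  then show ?thesis
    by (simp add: cinner_unitary_axis unitary_matrix_cancel[OF assms])
qed

lemma cinner_UDV:
  assumes "unitary_matrix U"
  shows "cinner ((U ** diag_matrix s ** adjoint_matrix V) *v x) (U *v axis i 1)
    = s i * cinner x (V *v axis i 1)"
  by (simp add: cinner_unitary_axis unitary_matrix_cancel[OF assms] diag_matrix_vector_mult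
      flip: matrix_vector_mul_assoc)

text \<open>With \<open>y\<close> the adjoint applied to \<open>x\<close>, the square of
  \<open>norm y\<close> equals \<open>cinner (T *v y) x\<close>; Cauchy-Schwarz and division by
  \<open>norm y\<close> finish.\<close>

lemma norm_adjoint_matrix_le:
  fixes T :: "complex ^ 'n ^ 'n"
  shows "norm (adjoint_matrix T *v x) \<le> onorm ((*v) T) * norm x"
proof (cases "adjoint_matrix T *v x = 0")
  case True
  then show ?thesis
    by (simp add: onorm_pos_le)
next
  case False
  let ?y = "adjoint_matrix T *v x"
  have "(norm ?y)\<^sup>2 = norm (cinner (T *v ?y) x)"
    by (simp only: cinner_adjoint_matrix cinner_self norm_of_real abs_power2)
  also have "\<dots> \<le> norm (T *v ?y) * norm x"
    by (rule cinner_Cauchy_Schwarz)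
  also have "\<dots> \<le> (onorm ((*v) T) * norm ?y) * norm x"
    by (intro mult_right_mono onorm) auto
  finally show ?thesis
    using False by (simp add: power2_eq_square)
qed

lemma disk_aut_denominator:
  assumes "norm z = 1" "norm a < 1"
  shows "1 + cnj a * z \<noteq> 0"
proof
  assume "1 + cnj a * z = 0"
  then have "norm (cnj a * z) = 1"
    by (metis add.inverse_unique norm_minus_cancel norm_one)
  then show False
    using assms by (simp add: norm_mult)
qed

lemma disk_aut_unimodular:
  assumes "norm z = 1" "norm a < 1" "norm l = 1"
  shows "disk_aut l a z * cnj (disk_aut l a z) = 1"
proof -
  have z: "z * cnj z = 1"
    using assms(1) by (simp add: complex_norm_square[symmetric])
  \<comment> \<open>On the circle the numerator is \<open>z\<close> times the conjugate of the
    denominator, so both have the same modulus.\<close>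
  have "z + a = z * cnj (1 + cnj a * z)"
    using z by (simp add: algebra_simps)
  then have "norm (z + a) = norm (1 + cnj a * z)"
    by (metis assms(1) complex_mod_cnj mult_1 norm_mult)
  then have "norm (disk_aut l a z) = 1"
    using disk_aut_denominator[OF assms(1,2)] assms(3) by (simp add: disk_aut_def norm_mult norm_divide)
  then show ?thesis
    by (simp add: complex_norm_square[symmetric])
qed

lemma continuous_on_UDV:
  assumes "\<And>i. continuous_on S (\<lambda>z. d i z)"
  shows "continuous_on S (\<lambda>z. U ** diag_matrix (\<lambda>i. d i z) ** adjoint_matrix V)"
proof -
  have "continuous_on S (\<lambda>z. if i = j then d i z else 0)" for i j
    using assms by (cases "i = j") auto
  then have "continuous_on S (\<lambda>z. diag_matrix (\<lambda>i. d i z))"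
    unfolding diag_matrix_def by (intro continuous_on_vec_lambda)
  then show ?thesis
    unfolding matrix_matrix_mult_def by (intro continuous_intros)
qed

text \<open>The concrete model of the abstract setting. On the circle \<open>B z\<close> is unitary,
  so the inverse of multiplication by \<open>B\<close> is multiplication by the adjoints. The
  columns of \<open>U\<close> and \<open>V\<close> serve as \<open>u\<close> and \<open>v\<close>,
  and \<open>B\<close> sends the \<open>i\<close>-th column of \<open>V\<close> to that of
  \<open>U\<close> times the scalar function \<open>disk_aut (l i) (a i)\<close>.\<close>

lemma nelson_dilation_pair:
  fixes T :: "complex ^ 'n ^ 'n"
  assumes U: "unitary_matrix U" and V: "unitary_matrix V" and T: "T = U ** diag_matrix s ** adjoint_matrix V"
    and l: "\<And>i. norm (l i) = 1" and a: "\<And>i. norm (a i) < 1" and s: "\<And>i. disk_aut (l i) (a i) 0 = s i"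
    and norm: "onorm ((*v) T) < 1"
  defines "B \<equiv> \<lambda>z. U ** diag_matrix (\<lambda>i. disk_aut (l i) (a i) z) ** adjoint_matrix V"
  shows "dilation_pair const_L2 (mult_op mat) (mult_op (\<lambda>z. mat (cnj z))) (mult_op B)
    (mult_op (\<lambda>z. adjoint_matrix (B z))) ((*v) T) (onorm ((*v) T))
    (\<lambda>i. U *v axis i 1) (\<lambda>i. V *v axis i 1) l a"
    and "continuous_on (sphere 0 1) B"
proof -
  have "continuous_on (sphere 0 1) (disk_aut (l i) (a i))" for i
    unfolding disk_aut_def using a by (intro continuous_intros) (auto simp: disk_aut_denominator)
  then show B: "continuous_on (sphere 0 1) B"
    unfolding B_def by (intro continuous_on_UDV)
  note adjB = continuous_on_adjoint_matrix[OF B]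
  have mat: "continuous_on (sphere 0 1) (\<lambda>z. mat z :: complex ^ 'n ^ 'n)"
      "continuous_on (sphere 0 1) (\<lambda>z. mat (cnj z) :: complex ^ 'n ^ 'n)"
    by (intro continuous_on_mat continuous_intros)+
  have diag: "diag_matrix (\<lambda>i. disk_aut (l i) (a i) z) ** adjoint_matrix (diag_matrix (\<lambda>i. disk_aut (l i) (a i) z)) = mat 1"
    "adjoint_matrix (diag_matrix (\<lambda>i. disk_aut (l i) (a i) z)) ** diag_matrix (\<lambda>i. disk_aut (l i) (a i) z) = mat 1"
    if "z \<in> sphere 0 1" for z
    using that a l
    by (simp_all add: adjoint_diag_matrix diag_matrix_mult disk_aut_unimodular diag_matrix_one
        mult.commute[of "cnj _"])
  have BB: "B z ** adjoint_matrix (B z) = mat 1" "adjoint_matrix (B z) ** B z = mat 1"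
    if "z \<in> sphere 0 1" for z
  proof -
    let ?D = "diag_matrix (\<lambda>i. disk_aut (l i) (a i) z)"
    have D: "?D *v (adjoint_matrix ?D *v x) = x" "adjoint_matrix ?D *v (?D *v x) = x" for x
      using diag[OF that] by (simp_all add: matrix_vector_mul_assoc)
    have "B z *v (adjoint_matrix (B z) *v x) = x" "adjoint_matrix (B z) *v (B z *v x) = x" for x
      unfolding B_def adjoint_matrix_mult adjoint_adjoint_matrix
      by (simp_all add: D unitary_matrix_cancel U V flip: matrix_vector_mul_assoc)
    then show "B z ** adjoint_matrix (B z) = mat 1" "adjoint_matrix (B z) ** B z = mat 1"
      by (simp_all add: matrix_eq matrix_vector_mul_assoc[symmetric])
  qed
  have unit: "z * cnj z = 1" if "z \<in> sphere 0 1" for z :: complex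
    using that by (simp add: complex_norm_square[symmetric])
  have id: "mult_op C (mult_op D x) = x"
    if "continuous_on (sphere 0 1) C" "continuous_on (sphere 0 1) D"
      "\<And>z. z \<in> sphere 0 1 \<Longrightarrow> C z ** D z = mat 1" for C D and x :: "'n L2"
  proof -
    have "mult_op (\<lambda>_. mat 1) = mult_op (\<lambda>z. C z ** D z)"
      by (rule mult_op_cong) (auto simp: that(3))
    then show ?thesis
      using mult_op_compose[OF that(1,2), of x] mult_op_id[of x] by metis
  qed
  show "dilation_pair const_L2 (mult_op mat) (mult_op (\<lambda>z. mat (cnj z))) (mult_op B)
    (mult_op (\<lambda>z. adjoint_matrix (B z))) ((*v) T) (onorm ((*v) T))
    (\<lambda>i. U *v axis i 1) (\<lambda>i. V *v axis i 1) l a"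
  proof
    fix x y :: "'n L2" and i :: 'n and w :: "complex ^ 'n"
    show "mult_op mat (mult_op (\<lambda>z. mat (cnj z)) x) = x" "mult_op (\<lambda>z. mat (cnj z)) (mult_op mat x) = x"
      by (auto intro!: id mat simp: mat_mult_mat unit mult.commute[of "cnj _"])
    show "mult_op B (mult_op (\<lambda>z. adjoint_matrix (B z)) x) = x"
      "mult_op (\<lambda>z. adjoint_matrix (B z)) (mult_op B x) = x"
      by (auto intro!: id B adjB simp: BB)
    show "cinner (mult_op mat x) y = cinner x (mult_op (\<lambda>z. mat (cnj z)) y)"
      using cinner_mult_op[OF mat(1)] by (simp add: adjoint_mat)
    show "cinner (mult_op B x) y = cinner x (mult_op (\<lambda>z. adjoint_matrix (B z)) y)"
      by (rule cinner_mult_op[OF B])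
    show "mult_op mat (mult_op B x) = mult_op B (mult_op mat x)"
      by (simp add: mult_op_compose mat(1) B mat_mult_commute)
    show "cinner (T *v w) (U *v axis i 1) = l i * a i * cinner w (V *v axis i 1)"
      using s[of i] by (simp add: T cinner_UDV[OF U] disk_aut_def)
    show "norm (T *v w) \<le> onorm ((*v) T) * norm w"
      by (intro onorm) simp
    let ?u = "U *v axis i 1" and ?v = "V *v axis i 1"
    have Bv: "B z *v ?v = scaleC (disk_aut (l i) (a i) z) ?u" for z
    proof -
      have "diag_matrix d *v axis i 1 = scaleC (d i) (axis i 1)" for d
        by (auto simp: vec_eq_iff diag_matrix_vector_mult axis_def scaleC_vec_def scaleC_complex_def)
      then show ?thesis
        by (simp add: B_def matrix_vector_mul_assoc[symmetric] unitary_matrix_cancel[OF V] matrix_vector_mult_scaleC)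
    qed
    \<comment> \<open>The Moebius relation holds pointwise on the circle; it is the definition of
      \<open>disk_aut\<close> with the nonzero denominator cleared.\<close>
    have ident: "B z *v ?v + scaleC (cnj (a i)) (mat z *v (B z *v ?v))
        = scaleC (l i) (mat z *v ?u + scaleC (a i) ?u)" if "z \<in> sphere 0 1" for z
    proof -
      have "disk_aut (l i) (a i) z + cnj (a i) * (z * disk_aut (l i) (a i) z) = l i * (z + a i)"
      proof -
        have "(1 + cnj (a i) * z) * disk_aut (l i) (a i) z = l i * (z + a i)"
          using disk_aut_denominator[of z "a i"] that a[of i] by (simp add: disk_aut_def)
        then show ?thesis
          by (simp only: distrib_right mult_1 mult.assoc)
      qed
      then show ?thesis
        by (simp add: Bv mat_vector_mult scaleC_scaleC flip: scaleC_add_left scaleC_add_right)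
    qed
    have si: "square_integrable (\<lambda>z. C z *v w)" if "continuous_on (sphere 0 1) C" for C :: "complex \<Rightarrow> complex ^ 'n ^ 'n" and w :: "complex ^ 'n"
      by (rule square_integrable_mult[OF that square_integrable_const])
    have "mult_op B (const_L2 ?v) + scaleC (cnj (a i)) (mult_op mat (mult_op B (const_L2 ?v)))
        = abs_L2 (\<lambda>z. B z *v ?v + scaleC (cnj (a i)) (mat z *v (B z *v ?v)))"
      using mat(1) B si[OF B] square_integrable_mult[OF mat(1) si[OF B]]
      by (simp add: const_L2_eq mult_op_abs square_integrable_const abs_L2_add abs_L2_scaleC square_integrable_scaleC)
    also have "\<dots> = abs_L2 (\<lambda>z. scaleC (l i) (mat z *v ?u + scaleC (a i) ?u))"
      using mat(1) B si[OF B] square_integrable_mult[OF mat(1) si[OF B]] si[OF mat(1)]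
      by (subst abs_L2_eq_iff)
        (auto intro!: square_integrable_add square_integrable_scaleC square_integrable_const AE_I2
          simp: ident space_circle_measure)
    also have "\<dots> = scaleC (l i) (mult_op mat (const_L2 ?u) + scaleC (a i) (const_L2 ?u))"
      using mat(1) si[OF mat(1)]
      by (simp add: const_L2_eq mult_op_abs square_integrable_const abs_L2_add abs_L2_scaleC
          square_integrable_scaleC square_integrable_add)
    finally show "mult_op B (const_L2 ?v) + scaleC (cnj (a i)) (mult_op mat (mult_op B (const_L2 ?v)))
      = scaleC (l i) (mult_op mat (const_L2 ?u) + scaleC (a i) (const_L2 ?u))" .
  qed (use a l norm mat B adjB in \<open>auto intro: complete_L2 isometry_const_L2 clinear_mult_op shift_wandering
      shift_total unitary_expansion U V onorm_pos_le\<close>)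
qed

section \<open>Power series and radial boundary values\<close>

lemma sum_abs_L2:
  fixes g :: "nat \<Rightarrow> complex \<Rightarrow> complex ^ 'n"
  assumes "\<And>n. square_integrable (g n)"
  shows "(\<Sum>n<N. abs_L2 (g n)) = abs_L2 (\<lambda>z. \<Sum>n<N. g n z) \<and> square_integrable (\<lambda>z. \<Sum>n<N. g n z)"
  by (induction N)
    (auto simp: assms abs_L2_add square_integrable_add square_integrable_const zero_L2.abs_eq)

text \<open>Inside the disk the Taylor series converges uniformly on the circle of radius
  \<open>r\<close>, hence also in norm, so the Fourier expansion of the dilate is its Taylor
  expansion.\<close>

lemma dilate_power_series:
  fixes F :: "complex \<Rightarrow> complex ^ 'n" and c :: "nat \<Rightarrow> complex ^ 'n"
  assumes F: "\<And>w i. w \<in> ball 0 1 \<Longrightarrow> (\<lambda>n. c n $ i * w ^ n) sums (F w $ i)"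
    and r: "0 \<le> r" "r < 1"
  shows "continuous_on (sphere 0 1) (\<lambda>z. F (of_real r * z))"
    and "(\<lambda>n. r ^ n *\<^sub>R abs_L2 (\<lambda>z. scaleC (z ^ n) (c n))) sums abs_L2 (\<lambda>z. F (of_real r * z))"
proof -
  define g where "g n z = r ^ n *\<^sub>R scaleC (z ^ n) (c n)" for n z
  have g_cont: "continuous_on (sphere 0 1) (g n)" for n
    unfolding g_def[abs_def] scaleC_vec_def scaleC_complex_def by (intro continuous_intros)
  have "summable (\<lambda>n. norm (c n $ i * of_real r ^ n))" for i
  proof (rule powser_insidea)
    \<comment> \<open>Any radius strictly between \<open>r\<close> and 1 would do: convergence there
      forces absolute convergence at \<open>r\<close>.\<close>
    show "summable (\<lambda>n. c n $ i * of_real ((1 + r) / 2) ^ n)"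
    proof (rule sums_summable[OF F])
      show "complex_of_real ((1 + r) / 2) \<in> ball 0 1"
        unfolding mem_ball_0 norm_of_real using r by simp
    qed
    show "norm (complex_of_real r) < norm (complex_of_real ((1 + r) / 2))"
      unfolding norm_of_real using r by simp
  qed
  then have "summable (\<lambda>n. \<Sum>i\<in>UNIV. norm (c n $ i * of_real r ^ n))"
    by (intro summable_sum)
  moreover have "norm (g n z) \<le> (\<Sum>i\<in>UNIV. norm (c n $ i * of_real r ^ n))" if "z \<in> sphere 0 1" for n z
  proof -
    have "norm (g n z) \<le> (\<Sum>i\<in>UNIV. norm (g n z $ i))"
      unfolding norm_vec_def by (rule L2_set_le_sum) simp
    also have "\<dots> = (\<Sum>i\<in>UNIV. norm (c n $ i * of_real r ^ n))"
      using that r by (intro sum.cong)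
        (auto simp: g_def scaleC_vec_def scaleC_complex_def norm_mult norm_power)
    finally show ?thesis .
  qed
  ultimately have unif: "uniform_limit (sphere 0 1) (\<lambda>N z. \<Sum>n<N. g n z) (\<lambda>z. \<Sum>n. g n z) sequentially"
    by (intro Weierstrass_m_test) auto
  have "(\<lambda>n. g n z) sums F (of_real r * z)" if "z \<in> sphere 0 1" for z
  proof -
    have "(\<lambda>N. (\<Sum>n<N. g n z) $ i) \<longlonglongrightarrow> F (of_real r * z) $ i" for i
    proof -
      have "(\<lambda>n. c n $ i * (of_real r * z) ^ n) sums (F (of_real r * z) $ i)"
        using that r by (intro F) (simp add: norm_mult)
      moreover have "(\<lambda>n. c n $ i * (of_real r * z) ^ n) = (\<lambda>n. g n z $ i)"
        by (auto simp: g_def scaleC_vec_def scaleC_complex_def power_mult_distrib scaleR_conv_of_real[where 'a = complex])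
      ultimately show ?thesis
        by (simp add: sums_def sum_component)
    qed
    then show ?thesis
      unfolding sums_def by (rule vec_tendstoI)
  qed
  then have "(\<Sum>n. g n z) = F (of_real r * z)" if "z \<in> sphere 0 1" for z
    using that by (simp add: sums_iff)
  then have unif: "uniform_limit (sphere 0 1) (\<lambda>N z. \<Sum>n<N. g n z) (\<lambda>z. F (of_real r * z)) sequentially"
    using unif by (subst (asm) uniform_limit_cong'[where g = "\<lambda>N z. \<Sum>n<N. g n z" and i = "\<lambda>z. F (of_real r * z)"]) auto
  show cont: "continuous_on (sphere 0 1) (\<lambda>z. F (of_real r * z))"
    by (rule uniform_limit_theorem[OF _ unif]) (auto intro!: always_eventually continuous_on_sum g_cont)
  have g_si: "square_integrable (g n)" for n
    by (intro square_integrable_continuous g_cont)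
  have g_abs: "abs_L2 (g n) = r ^ n *\<^sub>R abs_L2 (\<lambda>z. scaleC (z ^ n) (c n))" for n
    unfolding g_def[abs_def] scaleC_of_real[symmetric]
    by (subst abs_L2_scaleC) (auto intro!: square_integrable_monomial continuous_intros)
  have "(\<lambda>n. abs_L2 (g n)) sums abs_L2 (\<lambda>z. F (of_real r * z))"
    unfolding sums_def
  proof (rule LIMSEQ_I)
    fix e :: real assume e: "e > 0"
    have "\<forall>\<^sub>F N in sequentially. \<forall>z\<in>sphere 0 1. dist (\<Sum>n<N. g n z) (F (of_real r * z)) < e / 2"
      using e by (intro uniform_limitD[OF unif]) simp
    then obtain N0 where N0: "\<And>N z. N \<ge> N0 \<Longrightarrow> z \<in> sphere 0 1 \<Longrightarrow> dist (\<Sum>n<N. g n z) (F (of_real r * z)) < e / 2"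
      unfolding eventually_sequentially by blast
    have "norm ((\<Sum>n<N. abs_L2 (g n)) - abs_L2 (\<lambda>z. F (of_real r * z))) < e" if "N \<ge> N0" for N
    proof -
      have "norm (abs_L2 (\<lambda>z. (\<Sum>n<N. g n z) - F (of_real r * z))) \<le> e / 2"
        using N0[OF that] e sum_abs_L2[of g N, OF g_si] square_integrable_continuous[OF cont]
        by (intro norm_abs_L2_le square_integrable_diff) (auto simp: dist_norm less_imp_le)
      then show ?thesis
        using e sum_abs_L2[of g N, OF g_si] square_integrable_continuous[OF cont]
        by (simp add: abs_L2_diff)
    qed
    then show "\<exists>N0. \<forall>N\<ge>N0. norm ((\<Sum>n<N. abs_L2 (g n)) - abs_L2 (\<lambda>z. F (of_real r * z))) < e"
      by blast
  qed
  then show "(\<lambda>n. r ^ n *\<^sub>R abs_L2 (\<lambda>z. scaleC (z ^ n) (c n))) sums abs_L2 (\<lambda>z. F (of_real r * z))"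
    by (simp add: g_abs)
qed

lemma shift_pow_const_id: "(mult_op mat ^^ n) (const_L2 x) = abs_L2 (\<lambda>z. scaleC (z ^ n) x)"
  by (rule shift_pow_const[OF continuous_on_id])

text \<open>Dilates of a Hardy function are limits of polynomials and so lie in the closed space
  \<open>analytic\<close>, as does their boundary value. Conversely the coefficients of an analytic
  vector define a power series in the disk whose dilates are the Abel means of the orthogonal
  expansion.\<close>

lemma hardy_space_eq_analytic:
  fixes W Wi :: "'n::finite L2 \<Rightarrow> 'n L2"
  assumes "dilation_pair const_L2 (mult_op mat) (mult_op (\<lambda>z. mat (cnj z))) W Wi T q u v l a"
  shows "(hardy_space :: 'n L2 set) = dilation_pair.analytic const_L2 (mult_op (\<lambda>z. mat (cnj z)))"
proof -
  interpret dilation_pair const_L2 "mult_op mat" "mult_op (\<lambda>z. mat (cnj z))" W Wi T q u v l a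
    by (rule assms)
  have ev: "\<forall>\<^sub>F r::real in at_left 1. 0 \<le> r \<and> r < 1"
    by (rule eventually_mono[OF eventually_at_left_real[of 0 "1::real"]]) auto
  show ?thesis
  proof (intro subset_antisym subsetI)
    fix f :: "'n L2" assume "f \<in> hardy_space"
    then obtain F where F: "F \<in> hardy_class"
      and lim: "((\<lambda>r::real. abs_L2 (\<lambda>z. F (of_real r * z))) \<longlongrightarrow> f) (at_left 1)"
      by (auto simp: hardy_space_def)
    \<comment> \<open>The Taylor coefficients at 0.\<close>
    define c where "c n = (\<chi> i. (deriv ^^ n) (\<lambda>z. F z $ i) 0 / fact n)" for n
    have sums: "(\<lambda>n. c n $ i * w ^ n) sums (F w $ i)" if "w \<in> ball 0 1" for w i
      using holomorphic_power_series[of "\<lambda>z. F z $ i" 0 1 w] that F by (simp add: c_def hardy_class_def)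
    have "abs_L2 (\<lambda>z. F (of_real r * z)) \<in> analytic" if "0 \<le> r \<and> r < 1" for r
    proof -
      have "(\<lambda>N. \<Sum>n<N. r ^ n *\<^sub>R abs_L2 (\<lambda>z. scaleC (z ^ n) (c n))) \<longlonglongrightarrow> abs_L2 (\<lambda>z. F (of_real r * z))"
        using dilate_power_series(2)[OF sums] that by (simp add: sums_def)
      moreover have "(\<Sum>n<N. r ^ n *\<^sub>R abs_L2 (\<lambda>z. scaleC (z ^ n) (c n))) \<in> analytic" for N
        unfolding scaleC_of_real[symmetric] shift_pow_const_id[symmetric]
        by (intro cmod.subspace_sum cmod.subspace_scale subspace_analytic Z_pow_J_analytic)
      ultimately show ?thesis
        by (rule closed_sequentially[OF closed_analytic, rotated])
    qed
    then have "\<forall>\<^sub>F r in at_left 1. abs_L2 (\<lambda>z. F (complex_of_real r * z)) \<in> analytic"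
      using ev by (rule eventually_mono[rotated])
    then show "f \<in> analytic"
      by (rule Lim_in_closed_set[OF closed_analytic _ trivial_limit_at_left_real lim])
  next
    fix f assume f: "f \<in> analytic"
    define e where "e n = abs_L2 (\<lambda>z. scaleC (z ^ n) (coeff n f))" for n
    have e: "\<And>i j. i \<noteq> j \<Longrightarrow> orthogonal (e i) (e j)" "summable (\<lambda>n. (norm (e n))\<^sup>2)" "suminf e = f"
      using analytic_expansion[OF f] by (simp_all add: e_def[abs_def] shift_pow_const_id)
    \<comment> \<open>The coefficients are bounded by \<open>norm f\<close>, so the series converges
      in the open disk; dilates with \<open>r < 1\<close> evaluate \<open>F\<close> only
      there.\<close>
    define F where "F w = (\<chi> i. \<Sum>n. coeff n f $ i * w ^ n)" for w
    have sums: "(\<lambda>n. coeff n f $ i * w ^ n) sums (F w $ i)" if "w \<in> ball 0 1" for w i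
    proof -
      have "norm (coeff n f $ i) \<le> norm f" for n
        using Finite_Cartesian_Product.norm_nth_le[of "coeff n f" i] norm_coeff0[of "(mult_op (\<lambda>z. mat (cnj z)) ^^ n) f"]
        by (simp add: coeff_def norm_pow)
      then have le: "norm (coeff n f $ i * w ^ n) \<le> norm f * norm w ^ n" for n
        by (simp add: norm_mult norm_power mult_right_mono)
      have "summable (\<lambda>n. norm f * norm w ^ n)"
        using that by (intro summable_mult summable_geometric) simp
      then have "summable (\<lambda>n. coeff n f $ i * w ^ n)"
        by (rule summable_comparison_test') (rule le)
      then show ?thesis
        by (simp add: F_def summable_sums)
    qed
    have dilate: "abs_L2 (\<lambda>z. F (of_real r * z)) = (\<Sum>n. r ^ n *\<^sub>R e n)" if "0 \<le> r \<and> r < 1" for r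
      using dilate_power_series(2)[OF sums] that by (simp add: sums_iff e_def)
    have "F \<in> hardy_class"
      unfolding hardy_class_def
    proof (intro CollectI conjI allI exI impI)
      show "(\<lambda>z. F z $ i) holomorphic_on ball 0 1" for i
        by (rule power_series_holomorphic[where a = "\<lambda>n. coeff n f $ i"]) (use sums in simp)
      fix r :: real assume r: "0 \<le> r \<and> r < 1"
      then have "square_integrable (\<lambda>z. F (of_real r * z))"
        by (intro square_integrable_continuous dilate_power_series(1)[OF sums]) auto
      then have "(\<integral>z. (norm (F (of_real r * z)))\<^sup>2 \<partial>circle_measure) = (norm (\<Sum>n. r ^ n *\<^sub>R e n))\<^sup>2"
        by (simp add: norm_abs_L2[symmetric] dilate[OF r])
      also have "\<dots> \<le> (norm f)\<^sup>2"
        using orthogonal_series_Abel(3)[OF complete_L2 e(1,2)] r e(3) by (intro power_mono) auto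
      finally show "(\<integral>z. (norm (F (of_real r * z)))\<^sup>2 \<partial>circle_measure) \<le> (norm f)\<^sup>2" .
    qed
    moreover have "((\<lambda>r::real. abs_L2 (\<lambda>z. F (of_real r * z))) \<longlongrightarrow> f) (at_left 1)"
    proof (rule Lim_transform_eventually)
      show "((\<lambda>r::real. \<Sum>n. r ^ n *\<^sub>R e n) \<longlongrightarrow> f) (at_left 1)"
        using orthogonal_series_Abel(1)[OF complete_L2 e(1,2)] e(3) by simp
      show "\<forall>\<^sub>F r in at_left 1. (\<Sum>n. r ^ n *\<^sub>R e n) = abs_L2 (\<lambda>z. F (of_real r * z))"
        using ev by eventually_elim (simp add: dilate)
    qed
    ultimately show "f \<in> hardy_space"
      by (auto simp: hardy_space_def)
  qed
qed

theorem theorem1p1: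
  fixes T :: "complex ^ 'n ^ 'n" and That :: "complex \<Rightarrow> complex ^ 'n ^ 'n"
  assumes "onorm ((*v) T) < 1"
    and "nelson_dilation T That"
  shows "minimal_isometric_dilation const_L2 ((*v) T) hardy_space (mult_op That)
    \<and> minimal_unitary_dilation const_L2 ((*v) T) UNIV (mult_op That)"
proof -
  obtain U V s l a where data: "unitary_matrix U \<and> unitary_matrix V \<and>
      (\<forall>i. s i \<in> ball 0 1) \<and> T = U ** diag_matrix s ** adjoint_matrix V \<and>
      (\<forall>i. l i \<in> sphere 0 1 \<and> a i \<in> ball 0 1 \<and> disk_aut (l i) (a i) 0 = s i) \<and>
      (\<forall>z\<in>cball 0 1. That z =
        U ** diag_matrix (\<lambda>i. disk_aut (l i) (a i) z) ** adjoint_matrix V)"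
    using assms(2) unfolding nelson_dilation_def by blast
  then have UV: "unitary_matrix U" "unitary_matrix V"
    and T_eq: "T = U ** diag_matrix s ** adjoint_matrix V"
    and la: "\<And>i. norm (l i) = 1" "\<And>i. norm (a i) < 1" "\<And>i. disk_aut (l i) (a i) 0 = s i"
    by simp_all
  define B where "B z = U ** diag_matrix (\<lambda>i. disk_aut (l i) (a i) z) ** adjoint_matrix V" for z
  define Wi :: "'n L2 \<Rightarrow> 'n L2" where "Wi = mult_op (\<lambda>z. adjoint_matrix (B z))"
  note pair = nelson_dilation_pair[OF UV T_eq la assms(1), folded B_def]
  \<comment> \<open>A Nelson dilation is prescribed on the closed disk only, but multiplication sees
    just its values on the circle.\<close>
  have W: "mult_op That = mult_op B"
    by (rule mult_op_cong[symmetric, OF pair(2)]) (use data in \<open>simp add: B_def\<close>)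
  interpret dilation_pair const_L2 "mult_op mat" "mult_op (\<lambda>z. mat (cnj z))" "mult_op That" Wi
      "(*v) T" "onorm ((*v) T)" "\<lambda>i. U *v axis i 1" "\<lambda>i. V *v axis i 1" l a
    using pair(1) unfolding W Wi_def .
  \<comment> \<open>The adjoint exchanges \<open>U\<close> and \<open>V\<close> and conjugates the
    phased singular values, which is what the reversed pair asks of its matrix.\<close>
  have adjT: "adjoint_matrix T = V ** diag_matrix (\<lambda>i. cnj (s i)) ** adjoint_matrix U"
    by (simp add: T_eq adjoint_matrix_mult adjoint_diag_matrix matrix_mul_assoc)
  have reverse: "dilation_pair const_L2 (mult_op (\<lambda>z. mat (cnj z))) (mult_op mat) Wi (mult_op That)
      ((*v) (adjoint_matrix T)) (onorm ((*v) T)) (\<lambda>i. V *v axis i 1) (\<lambda>i. U *v axis i 1)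
      (\<lambda>i. cnj (l i)) (\<lambda>i. cnj (a i))"
  proof (rule reverse)
    show "cinner (adjoint_matrix T *v x) (V *v axis i 1) = cnj (l i) * cnj (a i) * cinner x (U *v axis i 1)" for x i
      using la(3)[of i] by (simp add: adjT cinner_UDV[OF UV(2)] disk_aut_def flip: complex_cnj_mult)
  qed (rule norm_adjoint_matrix_le)
  have hardy: "hardy_space = analytic"
    by (rule hardy_space_eq_analytic) unfold_locales
  have T_lin: "clinear_on UNIV ((*v) T)"
    by (simp add: clinear_on_def matrix_vector_right_distrib matrix_vector_mult_scaleC)
  have dilation: "is_dilation const_L2 ((*v) T) K (mult_op That)"
    if "hilbert_subspace K" "range const_L2 \<subseteq> K" for K
    unfolding is_dilation_def using that T_lin q J compression by auto
  have "hilbert_subspace (analytic :: 'n L2 set)"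
    using complete_closed_subset[OF closed_analytic subset_UNIV complete]
    by (simp add: hilbert_subspace_def subspace_analytic)
  then have "is_dilation const_L2 ((*v) T) analytic (mult_op That)"
    using J_analytic by (intro dilation) auto
  moreover have "is_dilation const_L2 ((*v) T) UNIV (mult_op That)"
    by (intro dilation) (simp_all add: hilbert_subspace_def complete)
  moreover have "isometry_on K (mult_op That)" for K
    using linear(3) by (simp add: isometry_on_def clinear_on_def norm_iso)
  \<comment> \<open>Surjectivity, with isometry, is the unitarity of multiplication on the whole
    space; the preimages come from \<open>Wi\<close>.\<close>
  moreover have "surj (mult_op That)"
    by (rule surjI) (rule inverse(3))
  moreover have "mult_op That ` analytic \<subseteq> analytic"
    using W_analytic by blast
  ultimately show ?thesis
    unfolding minimal_isometric_dilation_def minimal_unitary_dilation_def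
      isometric_dilation_def unitary_dilation_def hardy
    using analytic_eq_closure_span closure_span_int_iterate[OF reverse] by blast
qed

end
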